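(* Let $(Y,S)$ be a multiplicative topological dynamical system that is finitely generated and strongly uniquely ergodic, and let $\nu$ be the unique Borel probability measure on $Y$ that pretends to be invariant under $S$. Then $$\lim_{N\to\infty}\frac{1}{N}\sum_{n=1}^N g(S_n y)=\int g\,d\nu$$ for every $y\in Y$ and every $g\in C(Y)$.
   Context: $\mathbb{N}=\{1,2,3,\ldots\}$ and $\mathbb{P}$ is the set of prime numbers. $C(Y)$ is the space of continuous complex-valued functions on $Y$. A multiplicative topological dynamical system is a pair $(Y,S)$ where $Y$ is a compact metric space and $S=(S_n)_{n\in\mathbb{N}}$ is an action of the semigroup $(\mathbb{N},\cdot)$ on $Y$ by continuous maps, i.e. $S_{nm}=S_n\circ S_m$ for all $n,m\in\mathbb{N}$. It is finitely generated if there are finitely many continuous maps $R_1,\ldots,R_d\colon Y\to Y$ such that $S_p\in\{R_1,\ldots,R_d\}$ for all primes $p$. A Borel probability measure $\nu$ on $Y$ pretends to be invariant under $S$ if there exists a set $P\subset\mathbb{P}$ with $\sum_{p\in\mathbb{P}\setminus P}1/p<\infty$ such that $\nu$ is invariant under $S_p$ for all $p\in P$. $(Y,S)$ is strongly uniquely ergodic if there is exactly one Borel probability measure on $Y$ that pretends to be invariant under $S$. *)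

theory Defs
  imports "HOL-Probability.Probability" "HOL-Computational_Algebra.Primes"
begin

(* The space Y is the type 'a. Indices range over the positive integers, so S 0 is unconstrained.
   This is a semigroup action: S 1 is idempotent, but it is not required to be the identity. *)
definition mult_tds :: "(nat \<Rightarrow> 'a::metric_space \<Rightarrow> 'a) \<Rightarrow> bool" where
  "mult_tds S \<longleftrightarrow>
     compact (UNIV :: 'a set) \<and>
     (\<forall>n\<ge>1. continuous_on UNIV (S n)) \<and>
     (\<forall>n\<ge>1. \<forall>m\<ge>1. S (n * m) = S n \<circ> S m)"

definition finitely_generated :: "(nat \<Rightarrow> 'a::metric_space \<Rightarrow> 'a) \<Rightarrow> bool" where
  "finitely_generated S \<longleftrightarrow>
     (\<exists>R. finite R \<and> (\<forall>T\<in>R. continuous_on UNIV T) \<and> (\<forall>p. prime p \<longrightarrow> S p \<in> R))"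

definition borel_prob :: "'a::metric_space measure \<Rightarrow> bool" where
  "borel_prob \<nu> \<longleftrightarrow> sets \<nu> = sets borel \<and> prob_space \<nu>"

definition invariant_under :: "'a measure \<Rightarrow> ('a \<Rightarrow> 'a) \<Rightarrow> bool" where
  "invariant_under \<nu> T \<longleftrightarrow> T \<in> measurable \<nu> \<nu> \<and> distr \<nu> \<nu> T = \<nu>"

definition pretends_invariant ::
    "(nat \<Rightarrow> 'a::metric_space \<Rightarrow> 'a) \<Rightarrow> 'a measure \<Rightarrow> bool" where
  "pretends_invariant S \<nu> \<longleftrightarrow>
     (\<exists>P \<subseteq> {p. prime p}.
        (\<lambda>p. 1 / real p) summable_on ({p. prime p} - P) \<and>
        (\<forall>p\<in>P. invariant_under \<nu> (S p)))"

definition strongly_uniquely_ergodic :: "(nat \<Rightarrow> 'a::metric_space \<Rightarrow> 'a) \<Rightarrow> bool" where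
  "strongly_uniquely_ergodic S \<longleftrightarrow> (\<exists>!\<nu>. borel_prob \<nu> \<and> pretends_invariant S \<nu>)"

end

(* Idea. Write A g x = (1/x) * (sum of g (S n y) over n <= x) and colour the primes by S p. By the
   Turan-Kubilius inequality, A g x is close to the average of A (g o T) (x/p) over primes p of one colour
   T, weighted by 1/p, as soon as the sum of 1/p over these primes is large; moreover A g x varies slowly
   in log x. So if s is such that two families of primes of one colour can be matched with ratio close to
   exp s, then s is a period: A g (x exp s) - A g x tends to 0 for all g. The periods form a closed
   subgroup of the reals. Mertens' theorem and the pigeonhole principle on the finitely many colours show
   that it is nonzero. If it were cZ with c > 0, then for each colour the numbers log p mod c would
   concentrate at a single point, and by Dirichlet's approximation theorem the sum of
   cos (t log p) / p^(1+sigma) would be unbounded as sigma tends to 0, for some t = 2 pi k / c; but it is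
   log |zeta (1+sigma+it)| + O(1), which is bounded above. Hence every real number is a period, so
   A g x and A (g o T) x are asymptotically equal for every colour T with divergent sum of 1/p, and every
   weak limit of the empirical measures of the orbit pretends to be invariant. *)

theory Submission
  imports Defs "HOL-Number_Theory.Prime_Powers"
begin

section \<open>Averages and the Turan-Kubilius inequality\<close>

text \<open>The model obstruction is the rotation S_n z = n^(it) z of the circle with t nonzero. It
  satisfies every hypothesis except finite generation, yet the average of n^(it) up to x behaves
  like x^(it)/(1 + it), which oscillates with period 2 pi/t in log x. Finitely many colours must
  therefore be played off against such oscillations. Turan-Kubilius alone only relates g to g o T,
  about whose averages nothing is known. Two families of one colour, weighted alike and displaced by
  s, express A g (x exp s) and A g x through the same combination of averages of g o T, so the
  unknown drops out. A nonzero period has to come first: the numbers log p escape to infinity, and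
  only modulo a period c do they lie on a compact circle, where a colour class with divergent sum
  must accumulate.\<close>

definition avg :: "(nat \<Rightarrow> complex) \<Rightarrow> real \<Rightarrow> complex" where
  "avg f x = (\<Sum>n=1..nat \<lfloor>x\<rfloor>. f n) / of_real x"

text \<open>The terms between x and x' number at most x' - x + 1, the 1 being due to the floors. The
  change of normalisation costs another x' - x, as the partial sum up to x has norm at most
  x.\<close>

lemma norm_avg_diff_le:
  assumes f: "\<And>n. norm (f n) \<le> 1" and x: "0 < x" "x \<le> x'"
  shows "norm (avg f x' - avg f x) \<le> (2 * (x' - x) + 1) / x'"
proof -
  define T where "T x = (\<Sum>n=1..nat \<lfloor>x\<rfloor>. f n)" for x :: real
  have le: "nat \<lfloor>x\<rfloor> \<le> nat \<lfloor>x'\<rfloor>" using x by (intro nat_mono floor_mono)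
  have "{1..nat \<lfloor>x'\<rfloor>} = {1..nat \<lfloor>x\<rfloor>} \<union> {nat \<lfloor>x\<rfloor><..nat \<lfloor>x'\<rfloor>}" using le by auto
  then have "T x' - T x = (\<Sum>n\<in>{nat \<lfloor>x\<rfloor><..nat \<lfloor>x'\<rfloor>}. f n)"
    unfolding T_def by (simp only:) (subst sum.union_disjoint, auto)
  also have "norm \<dots> \<le> (\<Sum>n\<in>{nat \<lfloor>x\<rfloor><..nat \<lfloor>x'\<rfloor>}. 1)"
    by (rule sum_norm_le) (simp add: f)
  also have "\<dots> = real (nat \<lfloor>x'\<rfloor>) - real (nat \<lfloor>x\<rfloor>)" using le by simp
  also have "\<dots> \<le> x' - x + 1" using x by linarith
  finally have 1: "norm (T x' - T x) \<le> x' - x + 1" .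
  have "norm (T x) \<le> (\<Sum>n=1..nat \<lfloor>x\<rfloor>. 1)" unfolding T_def by (rule sum_norm_le) (simp add: f)
  also have "\<dots> \<le> x" using x by simp
  finally have 2: "norm (T x) \<le> x" .
  have "avg f x' - avg f x = (T x' - T x) / of_real x' - T x * of_real (1 / x - 1 / x')"
    using x by (simp add: avg_def T_def field_simps)
  also have "norm \<dots> \<le> norm ((T x' - T x) / of_real x') + norm (T x * of_real (1 / x - 1 / x'))"
    by (rule norm_triangle_ineq4)
  also have "\<dots> = norm (T x' - T x) / x' + norm (T x) * (1 / x - 1 / x')"
    using x by (simp add: norm_divide norm_mult frac_le del: of_real_diff of_real_divide)
  also have "\<dots> \<le> (x' - x + 1) / x' + x * (1 / x - 1 / x')"
    using x 1 2 by (intro add_mono divide_right_mono mult_right_mono) (auto simp: frac_le)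
  also have "\<dots> = (2 * (x' - x) + 1) / x'" using x by (simp add: field_simps)
  finally show ?thesis .
qed

text \<open>In the variable log x the average is 2-Lipschitz up to a vanishing error, since
  \<open>1 - exp (a - b) \<le> b - a\<close>. Both exponentials are kept to make the bound symmetric
  in u and v.\<close>

lemma norm_avg_exp_diff_le:
  assumes f: "\<And>n. norm (f n) \<le> 1" and x: "0 < x" and uv: "\<bar>u - v\<bar> \<le> d"
  shows "norm (avg f (x * exp u) - avg f (x * exp v)) \<le> 2 * d + (exp (-u) + exp (-v)) / x"
proof -
  have *: "norm (avg f (x * exp b) - avg f (x * exp a)) \<le> 2 * d + exp (- b) / x"
    if "a \<le> b" "b - a \<le> d" for a b
  proof -
    have "norm (avg f (x * exp b) - avg f (x * exp a)) \<le> (2 * (x * exp b - x * exp a) + 1) / (x * exp b)"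
      using that x by (intro norm_avg_diff_le f) auto
    also have "\<dots> = 2 * (1 - exp (a - b)) + exp (- b) / x"
      using x by (simp add: field_simps exp_diff exp_minus)
    also have "1 - exp (a - b) \<le> d" using exp_ge_add_one_self[of "a - b"] that by linarith
    finally show ?thesis by simp
  qed
  show ?thesis
  proof (cases "u \<le> v")
    case True
    then show ?thesis using *[of u v] uv x by (simp add: norm_minus_commute add_divide_distrib) 
      (smt (verit) divide_nonneg_pos exp_ge_zero)
  next
    case False
    then show ?thesis using *[of v u] uv x by (simp add: add_divide_distrib) 
      (smt (verit) divide_nonneg_pos exp_ge_zero)
  qed
qed

text \<open>The third d absorbs the error of order 1/x.\<close>

lemma eventually_avg_exp_diff_le:
  assumes f: "\<And>n. norm (f n) \<le> 1" and uv: "\<bar>u - v\<bar> \<le> d" and d: "0 < d"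
  shows "eventually (\<lambda>x. norm (avg f (x * exp u) - avg f (x * exp v)) \<le> 3 * d) at_top"
proof -
  have "((\<lambda>x. (exp (-u) + exp (-v)) / x) \<longlongrightarrow> 0) at_top"
    by (intro tendsto_divide_0[OF tendsto_const]) (auto intro: filterlim_at_top_imp_at_infinity filterlim_ident)
  then have "eventually (\<lambda>x. (exp (-u) + exp (-v)) / x < d) at_top" using d by (rule order_tendstoD)
  then show ?thesis using eventually_gt_at_top[of 0]
  proof eventually_elim
    case (elim x)
    then show ?case using norm_avg_exp_diff_le[of f x u v d, OF f elim(2) uv] by linarith
  qed
qed

section \<open>Divisibility counts and the variance of weighted sums of prime divisors\<close>

lemma multiples_eq_image:
  assumes "0 < (k::nat)"
  shows "{n\<in>{1..N}. k dvd n} = (\<lambda>m. k * m) ` {1..N div k}" (is "?A = ?B")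
proof
  show "?A \<subseteq> ?B"
  proof
    fix n assume "n \<in> ?A"
    then obtain m where m: "n = k * m" "1 \<le> n" "n \<le> N" by auto
    then have "m \<in> {1..N div k}"
      using assms by (cases m) (auto simp: less_eq_div_iff_mult_less_eq mult.commute)
    then show "n \<in> ?B" using m by blast
  qed
  show "?B \<subseteq> ?A"
    using assms by (auto simp: less_eq_div_iff_mult_less_eq mult.commute Suc_le_eq)
qed

lemma card_multiples: "0 < (k::nat) \<Longrightarrow> card {n\<in>{1..N}. k dvd n} = N div k"
  by (simp only: multiples_eq_image) (simp add: card_image inj_on_def)

lemma sum_multiples:
  fixes f :: "nat \<Rightarrow> 'a::comm_monoid_add"
  assumes "0 < (k::nat)"
  shows "(\<Sum>n\<in>{n\<in>{1..N}. k dvd n}. f n) = (\<Sum>m=1..N div k. f (k * m))"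
  using assms by (simp only: multiples_eq_image) (simp add: sum.reindex inj_on_def)

lemma tendsto_nat_floor_div:
  assumes "0 < (k::nat)"
  shows "((\<lambda>x. real (nat \<lfloor>x\<rfloor> div k) / x) \<longlongrightarrow> 1 / real k) at_top"
proof (rule tendsto_sandwich)
  show "eventually (\<lambda>x. 1 / real k - 2 / x \<le> real (nat \<lfloor>x\<rfloor> div k) / x) at_top"
    using eventually_gt_at_top[of 0]
  proof eventually_elim
    case (elim x)
    have "x - 1 \<le> real (nat \<lfloor>x\<rfloor>)" using elim by linarith
    also have "real (nat \<lfloor>x\<rfloor>) = real k * real (nat \<lfloor>x\<rfloor> div k) + real (nat \<lfloor>x\<rfloor> mod k)"
      by (metis mult_div_mod_eq of_nat_add of_nat_mult)
    also have "real (nat \<lfloor>x\<rfloor> mod k) \<le> real k - 1" using assms mod_less_divisor[of k "nat \<lfloor>x\<rfloor>"]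
      by linarith
    finally have "x - real k \<le> real k * real (nat \<lfloor>x\<rfloor> div k)" by linarith
    then have "x / real k - 1 \<le> real (nat \<lfloor>x\<rfloor> div k)" using assms by (simp add: field_simps)
    then have "(x / real k - 1) / x \<le> real (nat \<lfloor>x\<rfloor> div k) / x" using elim by (intro divide_right_mono) auto
    moreover have "(x / real k - 1) / x = 1 / real k - 1 / x" using elim by (simp add: diff_divide_distrib)
    moreover have "1 / x \<le> 2 / x" using elim by (intro divide_right_mono) auto
    ultimately show ?case by linarith
  qed
  show "eventually (\<lambda>x. real (nat \<lfloor>x\<rfloor> div k) / x \<le> 1 / real k) at_top"
    using eventually_gt_at_top[of 0]
  proof eventually_elim
    case (elim x)
    have "real (nat \<lfloor>x\<rfloor> div k) \<le> real (nat \<lfloor>x\<rfloor>) / real k" by (rule of_nat_div_le_of_nat)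
    also have "\<dots> \<le> x / real k" using elim by (intro divide_right_mono) auto
    finally show ?case using elim by (simp add: field_simps)
  qed
  have "((\<lambda>x. 1 / real k - 2 / x) \<longlongrightarrow> 1 / real k - 0) at_top"
    by (intro tendsto_diff tendsto_const tendsto_divide_0[OF tendsto_const])
       (auto intro: filterlim_at_top_imp_at_infinity filterlim_ident)
  then show "((\<lambda>x. 1 / real k - 2 / x) \<longlongrightarrow> 1 / real k) at_top" by simp
qed (rule tendsto_const)

lemma primes_dvd_both_iff:
  assumes "prime (p::nat)" "prime q"
  shows "p dvd n \<and> q dvd n \<longleftrightarrow> (if p = q then p else p * q) dvd n"
  using assms by (auto simp: primes_coprime intro: divides_mult dvd_mult_left dvd_mult_right)

text \<open>The second moment is that of a sum of independent events of probability \<open>1 / p\<close>, up to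
  \<open>o(x)\<close>: hence the variance below is at most \<open>\<Sum> p w\<^sub>p\<^sup>2\<close>.\<close>

lemma turan_kubilius:
  fixes w :: "nat \<Rightarrow> real"
  assumes fin: "finite B" and pr: "\<And>p. p \<in> B \<Longrightarrow> prime p" and w1: "sum w B = 1"
    and f: "\<And>n. norm (f n) \<le> 1"
    and small: "(\<Sum>p\<in>B. real p * (w p)\<^sup>2) < e\<^sup>2" and e: "0 < e"
  shows "eventually (\<lambda>x. norm (avg f x - (\<Sum>p\<in>B. of_real (w p) * avg (\<lambda>m. f (p * m)) (x / real p))) \<le> e) at_top"
proof -
  \<comment> \<open>The event that p divides n has density 1/p, so the weighted count has mean
    \<open>sum w B = 1\<close>, and \<open>D n\<close> is its deviation from the mean.\<close>
  define D where "D n = (\<Sum>p\<in>B. w p * real p * of_bool (p dvd n)) - 1" for n :: nat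
  define l where "l p q = (if p = q then p else p * q)" for p q :: nat
  have lpos: "0 < l p q" if "p \<in> B" "q \<in> B" for p q
    using pr[OF that(1)] pr[OF that(2)] by (auto simp: l_def prime_gt_0_nat)
  have both: "of_bool (p dvd n) * of_bool (q dvd n) = (of_bool (l p q dvd n) :: real)"
    if "p \<in> B" "q \<in> B" for p q n
    using primes_dvd_both_iff[OF pr[OF that(1)] pr[OF that(2)], of n]
    unfolding l_def of_bool_conj[symmetric] by presburger
  have D2: "(D n)\<^sup>2 = (\<Sum>p\<in>B. \<Sum>q\<in>B. w p * w q * real p * real q * of_bool (l p q dvd n))
      - 2 * (\<Sum>p\<in>B. w p * real p * of_bool (p dvd n)) + 1" for n
  proof -
    have "(D n)\<^sup>2 = (\<Sum>p\<in>B. w p * real p * of_bool (p dvd n)) * (\<Sum>q\<in>B. w q * real q * of_bool (q dvd n))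
      - 2 * (\<Sum>p\<in>B. w p * real p * of_bool (p dvd n)) + 1"
      by (simp add: D_def power2_eq_square algebra_simps)
    also have "(\<Sum>p\<in>B. w p * real p * of_bool (p dvd n)) * (\<Sum>q\<in>B. w q * real q * of_bool (q dvd n))
      = (\<Sum>p\<in>B. \<Sum>q\<in>B. w p * w q * real p * real q * of_bool (l p q dvd n))"
      unfolding sum_product by (intro sum.cong refl) (simp add: both[symmetric] mult_ac)
    finally show ?thesis .
  qed
  have cnt: "(\<Sum>n=1..N. of_bool (k dvd n)) = real (N div k)" if "0 < k" for N k :: nat
    using card_multiples[OF that, of N]
    by (simp add: of_bool_def sum.If_cases) (simp add: Int_def)
  define V where "V x = (\<Sum>n=1..nat \<lfloor>x\<rfloor>. (D n)\<^sup>2) / x" for x :: real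
  have V: "V x = (\<Sum>p\<in>B. \<Sum>q\<in>B. w p * w q * real p * real q * (real (nat \<lfloor>x\<rfloor> div l p q) / x))
      - 2 * (\<Sum>p\<in>B. w p * real p * (real (nat \<lfloor>x\<rfloor> div p) / x)) + real (nat \<lfloor>x\<rfloor> div 1) / x" for x
  proof -
    have "(\<Sum>n=1..nat \<lfloor>x\<rfloor>. (D n)\<^sup>2) = 
      (\<Sum>p\<in>B. \<Sum>q\<in>B. w p * w q * real p * real q * (\<Sum>n=1..nat \<lfloor>x\<rfloor>. of_bool (l p q dvd n)))
      - 2 * (\<Sum>p\<in>B. w p * real p * (\<Sum>n=1..nat \<lfloor>x\<rfloor>. of_bool (p dvd n))) + real (nat \<lfloor>x\<rfloor>)"
      unfolding D2 sum.distrib sum_subtractf sum_distrib_left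
      by (subst (2) sum.swap, subst (1) sum.swap, subst (1) sum.swap) (simp add: sum_distrib_left mult_ac)
    also have "\<dots> = (\<Sum>p\<in>B. \<Sum>q\<in>B. w p * w q * real p * real q * real (nat \<lfloor>x\<rfloor> div l p q))
      - 2 * (\<Sum>p\<in>B. w p * real p * real (nat \<lfloor>x\<rfloor> div p)) + real (nat \<lfloor>x\<rfloor>)"
      using pr by (intro arg_cong2[where f = "(+)"] arg_cong2[where f = "(-)"] arg_cong2[where f = "(*)"]
          sum.cong refl cnt lpos) (auto simp: prime_gt_0_nat)
    finally show ?thesis unfolding V_def
      by (simp add: add_divide_distrib diff_divide_distrib sum_divide_distrib sum_distrib_left mult_ac)
  qed
  have "(V \<longlongrightarrow> (\<Sum>p\<in>B. \<Sum>q\<in>B. w p * w q * real p * real q * (1 / real (l p q)))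
      - 2 * (\<Sum>p\<in>B. w p * real p * (1 / real p)) + 1 / real 1) at_top"
    unfolding V[abs_def] using lpos pr
    by (intro tendsto_intros tendsto_nat_floor_div) (auto simp: prime_gt_0_nat)
  also have "(\<Sum>p\<in>B. w p * real p * (1 / real p)) = 1"
    by (subst w1[symmetric], intro sum.cong refl) (use pr in \<open>auto dest: prime_gt_0_nat\<close>)
  \<comment> \<open>Distinct primes contribute \<open>w p * w q\<close>, as for independent events.
    The diagonal exceeds this by (p - 1) times the square of \<open>w p\<close>, and only this
    excess survives, because 1 - 2 + 1 = 0.\<close>
  also have "(\<Sum>p\<in>B. \<Sum>q\<in>B. w p * w q * real p * real q * (1 / real (l p q))) =
     (\<Sum>p\<in>B. \<Sum>q\<in>B. w p * w q + (if p = q then (real p - 1) * (w p)\<^sup>2 else 0))"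
    using pr by (intro sum.cong refl) (auto simp: l_def power2_eq_square field_simps dest!: prime_gt_0_nat)
  also have "\<dots> = sum w B * sum w B + (\<Sum>p\<in>B. (real p - 1) * (w p)\<^sup>2)"
    using fin by (simp add: sum.distrib sum.delta' sum_product)
  also have "sum w B * sum w B + (\<Sum>p\<in>B. (real p - 1) * (w p)\<^sup>2) - 2 * 1 + 1 / real 1
     = (\<Sum>p\<in>B. (real p - 1) * (w p)\<^sup>2)" by (simp add: w1)
  finally have "(V \<longlongrightarrow> (\<Sum>p\<in>B. (real p - 1) * (w p)\<^sup>2)) at_top" .
  moreover have "(\<Sum>p\<in>B. (real p - 1) * (w p)\<^sup>2) < e\<^sup>2"
    using small by (rule le_less_trans[rotated]) (auto intro!: sum_mono mult_right_mono)
  ultimately have "eventually (\<lambda>x. V x < e\<^sup>2) at_top" by (rule order_tendstoD)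
  then show ?thesis using eventually_gt_at_top[of 0]
  proof eventually_elim
    case (elim x)
    define N where "N = nat \<lfloor>x\<rfloor>"
    have N: "real N \<le> x" using elim by (simp add: N_def)
    have av: "avg (\<lambda>m. f (p * m)) (x / real p) = (\<Sum>n=1..N. f n * of_bool (p dvd n)) * of_nat p / of_real x"
      if "p \<in> B" for p
    proof -
      have "nat \<lfloor>x / real p\<rfloor> = N div p"
        unfolding N_def using floor_divide_real_eq_div[of "int p" x] elim by (simp add: nat_div_distrib)
      then have "avg (\<lambda>m. f (p * m)) (x / real p) = (\<Sum>m=1..N div p. f (p * m)) / of_real (x / real p)"
        by (simp add: avg_def)
      also have "(\<Sum>m=1..N div p. f (p * m)) = (\<Sum>n\<in>{n\<in>{1..N}. p dvd n}. f n)"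
        using pr[OF that] by (intro sum_multiples[symmetric]) (auto simp: prime_gt_0_nat)
      also have "\<dots> = (\<Sum>n=1..N. f n * of_bool (p dvd n))"
        by (rule sum.mono_neutral_cong_left) auto
      finally show ?thesis by simp
    qed
    have "(\<Sum>p\<in>B. of_real (w p) * avg (\<lambda>m. f (p * m)) (x / real p))
      = (\<Sum>p\<in>B. of_real (w p) * ((\<Sum>n=1..N. f n * of_bool (p dvd n)) * of_nat p / of_real x))"
      by (intro sum.cong refl) (simp only: av)
    also have "\<dots> = (\<Sum>p\<in>B. \<Sum>n=1..N. f n * of_real (w p * real p * of_bool (p dvd n)) / of_real x)"
      by (intro sum.cong refl, unfold sum_distrib_left sum_distrib_right sum_divide_distrib, intro sum.cong refl) auto
    also have "\<dots> = (\<Sum>n=1..N. \<Sum>p\<in>B. f n * of_real (w p * real p * of_bool (p dvd n))) / of_real x"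
      by (subst sum.swap) (simp only: sum_divide_distrib)
    \<comment> \<open>Exchanging the sums exhibits the difference as a correlation of f with
      \<open>D\<close>, which Cauchy-Schwarz bounds by the root of the variance
      \<open>V x\<close>.\<close>
    finally have "avg f x - (\<Sum>p\<in>B. of_real (w p) * avg (\<lambda>m. f (p * m)) (x / real p))
      = (\<Sum>n=1..N. f n - (\<Sum>p\<in>B. f n * of_real (w p * real p * of_bool (p dvd n)))) / of_real x"
      by (simp only: sum_subtractf diff_divide_distrib avg_def N_def)
    also have "(\<Sum>n=1..N. f n - (\<Sum>p\<in>B. f n * of_real (w p * real p * of_bool (p dvd n))))
      = (\<Sum>n=1..N. - f n * of_real (D n))"
      by (intro sum.cong refl) (simp add: D_def algebra_simps sum_distrib_left sum_negf)
    also have "norm (\<dots> / of_real x) = norm (\<Sum>n=1..N. - f n * of_real (D n)) / x"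
      using elim by (simp add: norm_divide)
    also have "norm (\<Sum>n=1..N. - f n * of_real (D n)) \<le> (\<Sum>n=1..N. 1 * \<bar>D n\<bar>)"
      by (rule sum_norm_le) (auto simp: norm_mult intro!: mult_left_le_one_le f)
    also have "\<dots> \<le> sqrt ((\<Sum>n=1..N. 1\<^sup>2) * (\<Sum>n=1..N. \<bar>D n\<bar>\<^sup>2))"
      by (rule real_le_rsqrt) (rule Cauchy_Schwarz_ineq_sum)
    also have "\<dots> = sqrt (real N * (x * V x))" using elim by (simp add: V_def N_def)
    also have "\<dots> \<le> sqrt (x * (x * e\<^sup>2))"
      using elim N by (intro real_sqrt_le_mono mult_mono) (auto simp: V_def intro!: sum_nonneg divide_nonneg_pos mult_nonneg_nonneg)
    also have "\<dots> = x * e" using elim e by (simp add: real_sqrt_mult real_sqrt_abs)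
    finally show ?case using elim by (simp add: divide_right_mono field_simps)
  qed
qed

section \<open>Mertens bounds on logarithmic windows\<close>

text \<open>Write ln n as the sum of \<open>mangoldt\<close> over the divisors of n and count, for
  each d, its N div d multiples. The bounds of Chebyshev and Mertens are both read off from this
  identity.\<close>

lemma ln_fact_eq_sum_mangoldt: "ln (fact N) = (\<Sum>d=1..N. mangoldt d * real (N div d))"
proof -
  have "ln (fact N :: real) = (\<Sum>n=1..N. ln (real n))"
    unfolding fact_prod of_nat_prod by (rule ln_prod) auto
  also have "\<dots> = (\<Sum>n=1..N. \<Sum>d=1..N. if d dvd n then mangoldt d else 0)"
  proof (intro sum.cong refl)
    fix n assume n: "n \<in> {1..N}"
    have "ln (real n) = (\<Sum>d | d dvd n. mangoldt d)" using mangoldt_sum[of n, where 'a=real] n by simp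
    also have "\<dots> = (\<Sum>d=1..N. if d dvd n then mangoldt d else 0)"
      using n by (subst sum.inter_filter[symmetric]) (auto intro!: sum.cong dest: dvd_imp_le simp: Suc_le_eq intro: Nat.gr0I)
    finally show "ln (real n) = (\<Sum>d=1..N. if d dvd n then mangoldt d else 0)" .
  qed
  also have "\<dots> = (\<Sum>d=1..N. \<Sum>n=1..N. if d dvd n then mangoldt d else 0)" by (rule sum.swap)
  also have "\<dots> = (\<Sum>d=1..N. mangoldt d * real (N div d))"
  proof (intro sum.cong refl)
    fix d assume "d \<in> {1..N}"
    then have "card {n\<in>{1..N}. d dvd n} = N div d" by (intro card_multiples) auto
    moreover have "(\<Sum>n=1..N. if d dvd n then mangoldt d else 0 :: real) = (\<Sum>n\<in>{n\<in>{1..N}. d dvd n}. mangoldt d)"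
      by (rule sum.inter_filter[symmetric]) simp
    ultimately show "(\<Sum>n=1..N. if d dvd n then mangoldt d else 0) = mangoldt d * real (N div d)"
      by simp
  qed
  finally show ?thesis .
qed

text \<open>Chebyshev's argument: the central binomial coefficient is at most 4^n, while in its
  logarithm the coefficient of \<open>mangoldt d\<close> is nonnegative for all d and at least 1 for
  n < d \<le> 2n.\<close>

lemma sum_mangoldt_double_le:
  "(\<Sum>d=1..2*n. mangoldt d) \<le> (\<Sum>d=1..n. mangoldt d) + 2 * real n"
proof -
  have "real ((2*n) choose n) = fact (2*n) / (fact n * fact n)"
    by (simp add: binomial_fact)
  then have "ln (real ((2*n) choose n)) = ln (fact (2*n)) - 2 * ln (fact n)"
    by (simp add: ln_div ln_mult)
  also have "ln (fact n) = (\<Sum>d=1..2*n. mangoldt d * real (n div d))"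
    unfolding ln_fact_eq_sum_mangoldt by (rule sum.mono_neutral_left) auto
  also have "ln (fact (2*n)) - 2 * \<dots> = (\<Sum>d=1..2*n. mangoldt d * (real (2 * n div d) - 2 * real (n div d)))"
    unfolding ln_fact_eq_sum_mangoldt sum_distrib_left sum_subtractf[symmetric]
    by (intro sum.cong refl) (simp add: algebra_simps)
  also have "\<dots> \<ge> (\<Sum>d=1..2*n. mangoldt d * of_bool (n < d))"
  proof (intro sum_mono mult_left_mono mangoldt_nonneg)
    fix d assume d: "d \<in> {1..2*n}"
    have "2 * (n div d) \<le> 2 * n div d"
      using d by (simp add: less_eq_div_iff_mult_less_eq Suc_le_eq)
    then have "2 * real (n div d) \<le> real (2 * n div d)" by linarith
    moreover have "n div d = 0" "1 \<le> 2 * n div d" if "n < d"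
      using d that by (simp_all add: less_eq_div_iff_mult_less_eq)
    then have "n div d = 0" "1 \<le> real (2 * n div d)" if "n < d"
      using that by (simp, metis of_nat_1 of_nat_le_iff)
    ultimately show "of_bool (n < d) \<le> real (2 * n div d) - 2 * real (n div d)"
      by (cases "n < d") auto
  qed
  also have "(\<Sum>d=1..2*n. mangoldt d * of_bool (n < d)) = (\<Sum>d\<in>{n<..2*n}. mangoldt d :: real)"
    by (rule sum.mono_neutral_cong_right) auto
  finally have "(\<Sum>d\<in>{n<..2*n}. mangoldt d) \<le> ln (real ((2*n) choose n))" .
  also have "\<dots> \<le> ln (2 ^ (2 * n))"
    using binomial_le_pow2[of "2*n" n] by (subst ln_le_cancel_iff) (auto simp del: of_nat_power simp flip: of_nat_power)
  also have "\<dots> \<le> 2 * real n" using ln_2_less_1 by (simp add: ln_realpow mult_left_le)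
  finally have "(\<Sum>d\<in>{n<..2*n}. mangoldt d) \<le> 2 * real n" .
  moreover have "(\<Sum>d=1..2*n. mangoldt d :: real) = (\<Sum>d=1..n. mangoldt d) + (\<Sum>d\<in>{n<..2*n}. mangoldt d)"
    by (subst sum.union_disjoint[symmetric]) (auto intro!: sum.cong)
  ultimately show ?thesis by linarith
qed

text \<open>After halving, the sum up to 2n is at most 6n; the constant 4 leaves room for the last
  term of an odd N = 2n + 1, which is at most N - 1 = 2n.\<close>

lemma sum_mangoldt_le: "(\<Sum>d=1..N. mangoldt d) \<le> 4 * real N"
proof (induction N rule: less_induct)
  case (less N)
  define n where "n = N div 2"
  show ?case
  proof (cases "N = 0")
    case False
    then have IH: "(\<Sum>d=1..n. mangoldt d) \<le> 4 * real n" by (intro less) (auto simp: n_def)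
    have 1: "(\<Sum>d=1..2*n. mangoldt d) \<le> 6 * real n" using IH sum_mangoldt_double_le[of n] by linarith
    consider "N = 2 * n" | "N = Suc (2 * n)" by (cases "even N") (auto simp: n_def elim!: evenE oddE)
    then show ?thesis
    proof cases
      case 2
      have "mangoldt N \<le> ln (real N)" using False by (intro mangoldt_le) auto
      also have "\<dots> \<le> real N - 1" using False by (intro ln_le_minus_one) auto
      finally show ?thesis using 1 2 by simp
    qed (use 1 in simp)
  qed simp
qed

text \<open>Replacing N div d by N / d in the formula for ln N! costs at most the sum of
  \<open>mangoldt\<close>, that is 4N by Chebyshev's bound.\<close>

lemma sum_mangoldt_div_le:
  assumes "0 < N"
  shows "(\<Sum>d=1..N. mangoldt d / real d) \<le> ln (real N) + 4"
proof -
  have "real N * (\<Sum>d=1..N. mangoldt d / real d) \<le> (\<Sum>d=1..N. mangoldt d * (real (N div d) + 1))"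
    unfolding sum_distrib_left
  proof (rule sum_mono)
    fix d assume d: "d \<in> {1..N}"
    have "real N = real d * real (N div d) + real (N mod d)"
      by (metis mult_div_mod_eq of_nat_add of_nat_mult)
    also have "real (N mod d) \<le> real d" using d by simp
    finally have "real N / real d \<le> real (N div d) + 1" using d by (simp add: field_simps)
    then have "mangoldt d * (real N / real d) \<le> mangoldt d * (real (N div d) + 1)"
      by (rule mult_left_mono) (rule mangoldt_nonneg)
    then show "real N * (mangoldt d / real d) \<le> mangoldt d * (real (N div d) + 1)" by (simp add: mult_ac)
  qed
  also have "\<dots> = ln (fact N) + (\<Sum>d=1..N. mangoldt d)"
    by (simp add: ln_fact_eq_sum_mangoldt distrib_left sum.distrib)
  also have "ln (fact N :: real) \<le> ln (real N ^ N)"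
    using assms fact_le_power[of N, where 'a=real] by (subst ln_le_cancel_iff) auto
  also have "\<dots> = real N * ln (real N)" using assms by (simp add: ln_realpow)
  finally have "real N * (\<Sum>d=1..N. mangoldt d / real d) \<le> real N * (ln (real N) + 4)"
    using sum_mangoldt_le[of N] by (simp add: distrib_left)
  then show ?thesis using assms by simp
qed

text \<open>A weak form of Stirling's formula, by induction from n ln (1 + 1/n) \<le> 1.\<close>

lemma ln_fact_ge: "real N * ln (real N) - real N \<le> ln (fact N)"
proof (induction N)
  case (Suc n)
  show ?case
  proof (cases "n = 0")
    case False
    have "ln (real (Suc n)) - ln (real n) = ln (real (Suc n) / real n)"
      using False by (simp add: ln_div)
    also have "real (Suc n) / real n = 1 + 1 / real n"
      using False by (simp add: field_simps)
    also have "ln (1 + 1 / real n) \<le> 1 / real n" by (rule ln_add_one_self_le_self) simp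
    finally have "real n * (ln (real (Suc n)) - ln (real n)) \<le> 1" 
      using False by (simp add: field_simps)
    moreover have "ln (fact (Suc n) :: real) = ln (real (Suc n)) + ln (fact n)"
      by (simp add: ln_mult)
    ultimately show ?thesis using Suc by (simp add: algebra_simps)
  qed simp
qed simp

text \<open>In this direction the floors only help, since N div d \<le> N / d; the 1 is the loss in
  the Stirling bound.\<close>

lemma sum_mangoldt_div_ge:
  assumes "0 < N"
  shows "ln (real N) - 1 \<le> (\<Sum>d=1..N. mangoldt d / real d)"
proof -
  have "real N * (ln (real N) - 1) \<le> ln (fact N)" using ln_fact_ge[of N] by (simp add: algebra_simps)
  also have "\<dots> \<le> real N * (\<Sum>d=1..N. mangoldt d / real d)"
    unfolding ln_fact_eq_sum_mangoldt sum_distrib_left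
  proof (rule sum_mono)
    fix d
    have "mangoldt d * real (N div d) \<le> mangoldt d * (real N / real d)"
      by (intro mult_left_mono mangoldt_nonneg of_nat_div_le_of_nat)
    then show "mangoldt d * real (N div d) \<le> real N * (mangoldt d / real d)" by (simp add: mult_ac)
  qed
  finally show ?thesis using assms by simp
qed

lemma summable_ln_div_square: "summable (\<lambda>n. 2 * ln (real n) / (real n)\<^sup>2)"
proof (rule summable_comparison_test')
  show "summable (\<lambda>n. 4 * real n powr (-3/2))"
    by (intro summable_mult) (simp add: summable_real_powr_iff)
  fix n :: nat assume n: "1 \<le> n"
  have "ln (real n) \<le> 2 * real n powr (1/2)"
    using ln_powr_bound[of "real n" "1/2"] n by simp
  then have "2 * ln (real n) / (real n)\<^sup>2 \<le> 2 * (2 * real n powr (1/2)) / (real n)\<^sup>2"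
    by (intro divide_right_mono) auto
  also have "\<dots> = 4 * real n powr (-3/2)"
    using n powr_diff[of "real n" "1/2" 2] by simp
  finally show "norm (2 * ln (real n) / (real n)\<^sup>2) \<le> 4 * real n powr (-3/2)" using n by simp
qed

text \<open>Only the powers p^k with k \<ge> 2 contribute. For fixed p they form a geometric series
  of ratio 1/p \<le> 1/2, whence the factor 2.\<close>

lemma sum_mangoldt_nonprime_le:
  "(\<Sum>d\<in>{d\<in>{1..N}. \<not> prime d}. mangoldt d / real d) \<le> (\<Sum>n. 2 * ln (real n) / (real n)\<^sup>2)"
proof -
  define A where "A = (SIGMA p:{p\<in>{1..N}. prime p}. {2..N})"
  have "(\<Sum>d\<in>{d\<in>{1..N}. \<not> prime d}. mangoldt d / real d) = (\<Sum>d\<in>{d\<in>{1..N}. \<not> prime d \<and> primepow d}. mangoldt d / real d)"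
    by (rule sum.mono_neutral_right) (auto simp: mangoldt_def)
  also have "\<dots> \<le> (\<Sum>d\<in>(\<lambda>(p,k). p ^ k) ` A. mangoldt d / real d)"
  proof (rule sum_mono2)
    show "finite ((\<lambda>(p,k). p ^ k) ` A)" by (auto simp: A_def)
    show "{d\<in>{1..N}. \<not> prime d \<and> primepow d} \<subseteq> (\<lambda>(p,k). p ^ k) ` A"
    proof clarsimp
      fix d assume d: "Suc 0 \<le> d" "d \<le> N" "\<not> prime d" "primepow d"
      then obtain p k where pk: "prime p" "0 < k" "d = p ^ k" by (auto simp: primepow_def)
      have "k \<noteq> 1" using pk d by auto
      moreover have "p \<le> d" using pk prime_gt_0_nat[of p] self_le_power[of p k] by simp
      moreover have "k < d" using pk prime_gt_1_nat[of p] by (simp add: power_gt_expt)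
      ultimately have "(p, k) \<in> A" using pk d prime_gt_0_nat[of p] by (auto simp: A_def)
      then show "d \<in> (\<lambda>(p,k). p ^ k) ` A" using pk by force
    qed
  qed (auto intro!: divide_nonneg_nonneg mangoldt_nonneg)
  also have "\<dots> \<le> (\<Sum>x\<in>A. mangoldt ((\<lambda>(p,k). p ^ k) x) / real ((\<lambda>(p,k). p ^ k) x))"
    by (rule sum_image_le[where g="\<lambda>d. mangoldt d / real d", unfolded o_def]) (auto simp: A_def intro!: divide_nonneg_nonneg mangoldt_nonneg)
  also have "\<dots> = (\<Sum>p\<in>{p\<in>{1..N}. prime p}. \<Sum>k=2..N. ln (real p) / real p ^ k)"
    unfolding A_def by (subst sum.Sigma) (auto intro!: sum.cong)
  also have "\<dots> \<le> (\<Sum>p\<in>{p\<in>{1..N}. prime p}. 2 * ln (real p) / (real p)\<^sup>2)"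
  proof (rule sum_mono)
    fix p assume p: "p \<in> {p\<in>{1..N}. prime p}"
    then have p2: "2 \<le> p" by (auto dest: prime_ge_2_nat)
    have "(\<Sum>k=2..N. ln (real p) / real p ^ k) \<le> (\<Sum>k=2..<2+N. ln (real p) / real p ^ k)"
      using p2 by (intro sum_mono2) auto
    also have "\<dots> = ln (real p) / (real p)\<^sup>2 * (\<Sum>k<N. (1 / real p) ^ k)"
      by (subst sum.atLeastLessThan_shift_0) (simp add: sum_distrib_left lessThan_atLeast0 power_add power_divide power2_eq_square mult_ac)
    also have "(\<Sum>k<N. (1 / real p) ^ k) \<le> (\<Sum>k<N. (1 / 2) ^ k)"
      using p2 by (intro sum_mono power_mono) (auto simp: field_simps)
    also have "\<dots> \<le> 2" by (simp add: sum_gp_strict)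
    finally show "(\<Sum>k=2..N. ln (real p) / real p ^ k) \<le> 2 * ln (real p) / (real p)\<^sup>2"
      using p2 by (simp add: mult_left_mono field_simps)
  qed
  also have "\<dots> \<le> (\<Sum>n. 2 * ln (real n) / (real n)\<^sup>2)"
  proof (rule sum_le_suminf[OF summable_ln_div_square])
    fix n :: nat show "0 \<le> 2 * ln (real n) / (real n)\<^sup>2" by (cases n) auto
  qed auto
  finally show ?thesis .
qed

section \<open>Primes in windows of bounded logarithmic length\<close>

definition primes_ln_Ico :: "real \<Rightarrow> real \<Rightarrow> nat set" where
  "primes_ln_Ico a b = {p. prime p \<and> a \<le> ln (real p) \<and> ln (real p) < b}"

lemma finite_primes_ln_Ico [simp]: "finite (primes_ln_Ico a b)"
proof (rule finite_subset)
  show "primes_ln_Ico a b \<subseteq> {..nat \<lceil>exp b\<rceil>}"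
  proof
    fix p assume "p \<in> primes_ln_Ico a b"
    then have "exp (ln (real p)) < exp b" "0 < p"
      by (auto simp del: exp_ln_iff exp_ln simp: primes_ln_Ico_def prime_gt_0_nat)
    then show "p \<in> {..nat \<lceil>exp b\<rceil>}" by simp linarith
  qed
qed simp

lemma mertens_window:
  obtains D where "0 < D" "\<And>u. 0 \<le> u \<Longrightarrow> 1 \<le> (\<Sum>p\<in>primes_ln_Ico u (u + D). ln (real p) / real p)"
proof -
  define C where "C = (\<Sum>n. 2 * ln (real n) / (real n)\<^sup>2)"
  have C0: "0 \<le> C" unfolding C_def
  proof (rule suminf_nonneg[OF summable_ln_div_square])
    fix n :: nat show "0 \<le> 2 * ln (real n) / (real n)\<^sup>2" by (cases n) auto
  qed
  \<comment> \<open>The two Mertens bounds lose 1 + 4, the higher prime powers lose C, rounding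
    \<open>N1\<close> loses 2 ln 2 < 2, and 1 is to be reached.\<close>
  define D where "D = C + 8"
  have "1 \<le> (\<Sum>p\<in>primes_ln_Ico u (u + D). ln (real p) / real p)" if u: "0 \<le> u" for u
  proof -
    define N0 where "N0 = nat \<lfloor>exp u\<rfloor>"
    \<comment> \<open>Halving keeps every prime up to \<open>N1\<close> strictly below exp (u + D),
      as the half-open window demands.\<close>
    define N1 where "N1 = nat \<lfloor>exp (u + D) / 2\<rfloor>"
    have e1: "1 \<le> exp u" using u by simp
    then have N0: "0 < N0" "real N0 \<le> exp u" by (auto simp: N0_def)
    have "4 \<le> exp D" using exp_ge_add_one_self[of D] C0 by (simp add: D_def)
    then have e4: "4 * exp u \<le> exp (u + D)" by (simp add: exp_add)
    have "real N1 \<le> exp (u + D) / 2" "exp (u + D) / 2 - 1 \<le> real N1"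
      unfolding N1_def using exp_gt_zero[of "u + D"] by linarith+
    then have N1: "0 < N1" "real N1 < exp (u + D)" "exp (u + D) / 4 \<le> real N1"
      using e1 e4 by linarith+
    have le: "N0 \<le> N1" using e1 e4 unfolding N0_def N1_def by (intro nat_mono floor_mono) linarith
    have "ln (exp (u + D) / 4) \<le> ln (real N1)" using N1 by (subst ln_le_cancel_iff) auto
    moreover have "ln (exp (u + D) / 4) = u + D - 2 * ln 2"
      using ln_realpow[of 2 2] by (simp add: ln_div)
    ultimately have l1: "u + D - 2 * ln 2 \<le> ln (real N1)" by simp
    have "ln (real N0) \<le> ln (exp u)" using N0 by (subst ln_le_cancel_iff) auto
    then have l0: "ln (real N0) \<le> u" by simp
    have "(\<Sum>d=1..N1. mangoldt d / real d) = (\<Sum>d=1..N0. mangoldt d / real d) + (\<Sum>d\<in>{N0<..N1}. mangoldt d / real d)"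
      using le by (subst sum.union_disjoint[symmetric]) (auto intro!: sum.cong)
    then have "ln (real N1) - 1 - (ln (real N0) + 4) \<le> (\<Sum>d\<in>{N0<..N1}. mangoldt d / real d)"
      using sum_mangoldt_div_ge[OF N1(1)] sum_mangoldt_div_le[OF N0(1)] by linarith
    also have "\<dots> = (\<Sum>d\<in>{d\<in>{N0<..N1}. prime d}. mangoldt d / real d) + (\<Sum>d\<in>{d\<in>{N0<..N1}. \<not> prime d}. mangoldt d / real d)"
      by (subst sum.union_disjoint[symmetric]) (auto intro!: sum.cong)
    also have "(\<Sum>d\<in>{d\<in>{N0<..N1}. \<not> prime d}. mangoldt d / real d) \<le> (\<Sum>d\<in>{d\<in>{1..N1}. \<not> prime d}. mangoldt d / real d)"
      by (intro sum_mono2) (auto intro!: divide_nonneg_nonneg mangoldt_nonneg)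
    also have "\<dots> \<le> C" unfolding C_def by (rule sum_mangoldt_nonprime_le)
    also have "(\<Sum>d\<in>{d\<in>{N0<..N1}. prime d}. mangoldt d / real d) = (\<Sum>d\<in>{d\<in>{N0<..N1}. prime d}. ln (real d) / real d)"
      by (intro sum.cong refl) auto
    also have "\<dots> \<le> (\<Sum>p\<in>primes_ln_Ico u (u + D). ln (real p) / real p)"
    proof (rule sum_mono2)
      show "{d\<in>{N0<..N1}. prime d} \<subseteq> primes_ln_Ico u (u + D)"
      proof
        fix d assume d: "d \<in> {d\<in>{N0<..N1}. prime d}"
        then have d0: "0 < real d" by auto
        have "exp u < real d" using d unfolding N0_def by simp linarith
        then have "u < ln (real d)" using d0 by (metis exp_less_cancel_iff exp_ln)
        moreover have "real d < exp (u + D)" using d N1(2) by simp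
        then have "ln (real d) < u + D" using d0 by (metis exp_less_cancel_iff exp_ln)
        ultimately show "d \<in> primes_ln_Ico u (u + D)" using d by (simp add: primes_ln_Ico_def)
      qed
    qed (simp, auto simp: primes_ln_Ico_def Suc_le_eq prime_gt_0_nat intro!: divide_nonneg_nonneg)
    finally show ?thesis using l1 l0 ln_2_less_1 by (simp add: D_def)
  qed
  moreover have "0 < D" using C0 by (simp add: D_def)
  ultimately show ?thesis using that by blast
qed

section \<open>The zeta function near the line Re s = 1\<close>

text \<open>The 3 is 1 + 2: the linear term at a has slope at most B, and the derivative deviates
  from its value at a by at most 2B.\<close>

lemma norm_diff_le_of_vector_derivative:
  fixes f :: "real \<Rightarrow> complex"
  assumes "\<And>x. x \<in> {a..b} \<Longrightarrow> (f has_vector_derivative f' x) (at x within {a..b})"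
    and "\<And>x. x \<in> {a..b} \<Longrightarrow> norm (f' x) \<le> B" and "y \<in> {a..b}" "0 \<le> B" "a \<le> b"
  shows "norm (f y - f a) \<le> 3 * (y - a) * B"
proof -
  have "norm (f y - f a - (y - a) *\<^sub>R f' a) \<le> norm (y - a) * (2 * B)"
  proof (rule vector_differentiable_bound_linearization[OF assms(1)])
    show "norm (f' x - f' a) \<le> 2 * B" if "x \<in> {a..b}" for x
      using norm_triangle_ineq4[of "f' x" "f' a"] assms(2)[OF that] assms(2)[of a] assms(5) by auto
  qed (use assms in \<open>auto simp: closed_segment_eq_real_ivl\<close>)
  moreover have "norm ((y - a) *\<^sub>R f' a) \<le> (y - a) * B"
    using assms by (auto intro!: mult_left_mono)
  moreover have "norm (y - a) = y - a" using assms by auto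
  ultimately show ?thesis
    using norm_triangle_ineq[of "f y - f a - (y - a) *\<^sub>R f' a" "(y - a) *\<^sub>R f' a"]
    by (simp add: algebra_simps)
qed

text \<open>The term n^(-s) of the Dirichlet series of zeta, for n \<ge> 1.\<close>

definition npow :: "complex \<Rightarrow> nat \<Rightarrow> complex" where
  "npow s n = exp (- (s * of_real (ln (real n))))"

lemma norm_npow: "0 < n \<Longrightarrow> norm (npow s n) = real n powr (- Re s)"
  by (simp add: npow_def powr_def)

lemma npow_mult: "0 < m \<Longrightarrow> 0 < n \<Longrightarrow> npow s (m * n) = npow s m * npow s n"
  by (simp add: npow_def ln_mult exp_add[symmetric] algebra_simps)

lemma npow_1 [simp]: "npow s (Suc 0) = 1"
  by (simp add: npow_def)

text \<open>\<open>G\<close> is an antiderivative of x^(-s), which moves by at most 3 |s| / n^2 on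
  [n, n + 1] because its derivative is at most |s| / x^2 there. Linearising \<open>G\<close> at n
  compares n^(-s) with the integral over this interval.\<close>

lemma npow_minus_integral_le:
  assumes s: "s \<noteq> 1" "1 \<le> Re s" and n: "0 < n"
  defines "G \<equiv> \<lambda>x::real. exp ((1 - s) * of_real (ln x)) / (1 - s)"
  shows "norm (npow s n - (G (real (Suc n)) - G (real n))) \<le> 3 * norm s / (real n)\<^sup>2"
proof -
  define g where "g x = exp (- (s * of_real (ln x)))" for x :: real
  let ?S = "{real n..real (Suc n)}"
  have dg: "(g has_vector_derivative (- s / of_real x * g x)) (at x within ?S)"
    and dG: "(G has_vector_derivative g x) (at x within ?S)" if "x \<in> ?S" for x
  proof -
    have x: "0 < x" using that n by auto
    have l: "((\<lambda>x. complex_of_real (ln x)) has_vector_derivative of_real (1 / x)) (at x within ?S)"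
      using x by (intro has_vector_derivative_of_real) (auto intro!: derivative_eq_intros simp flip: has_real_derivative_iff_has_vector_derivative simp: divide_inverse)
    have "((\<lambda>x. - (s * of_real (ln x))) has_vector_derivative - (s * of_real (1 / x))) (at x within ?S)"
      by (intro has_vector_derivative_minus has_vector_derivative_mult_right l)
    from field_vector_diff_chain_within[OF this, of exp "exp (- (s * of_real (ln x)))"]
    show "(g has_vector_derivative (- s / of_real x * g x)) (at x within ?S)"
      by (simp add: o_def g_def[abs_def] DERIV_subset[OF DERIV_exp] mult_ac)
    have "((\<lambda>x. (1 - s) * of_real (ln x)) has_vector_derivative (1 - s) * of_real (1 / x)) (at x within ?S)"
      by (intro has_vector_derivative_mult_right l)
    from field_vector_diff_chain_within[OF this, of exp "exp ((1 - s) * of_real (ln x))"]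
    have "((\<lambda>x. exp ((1 - s) * of_real (ln x))) has_vector_derivative (1 - s) * of_real (1 / x) * exp ((1 - s) * of_real (ln x))) (at x within ?S)"
      by (simp add: o_def DERIV_subset[OF DERIV_exp])
    then have "((\<lambda>x. exp ((1 - s) * of_real (ln x)) * (1 / (1 - s))) has_vector_derivative 
        (1 - s) * of_real (1 / x) * exp ((1 - s) * of_real (ln x)) * (1 / (1 - s))) (at x within ?S)"
      by (rule has_vector_derivative_mult_left)
    moreover have "exp ((1 - s) * of_real (ln x)) = of_real x * g x"
      using x by (simp add: g_def left_diff_distrib exp_diff exp_minus divide_inverse exp_of_real)
    ultimately show "(G has_vector_derivative g x) (at x within ?S)"
      using x s by (simp add: G_def)
  qed
  have bound: "norm (- s / of_real x * g x) \<le> norm s / (real n)\<^sup>2" if "x \<in> ?S" for x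
  proof -
    have x: "real n \<le> x" "0 < x" "1 \<le> x" using that n by auto
    have "norm (g x) = x powr (- Re s)" using x by (simp add: g_def powr_def)
    also have "\<dots> \<le> x powr (- 1)" using s x by (intro powr_mono) auto
    also have "\<dots> = 1 / x" using x by (simp add: powr_minus_divide)
    finally have "norm (- s / of_real x * g x) \<le> norm s / x * (1 / x)"
      using x unfolding norm_mult by (intro mult_mono) (auto simp: norm_divide)
    also have "\<dots> = norm s / x\<^sup>2" by (simp add: power2_eq_square)
    also have "\<dots> \<le> norm s / (real n)\<^sup>2" using x n by (intro divide_left_mono power_mono) auto
    finally show ?thesis .
  qed
  have d: "norm (g x - g (real n)) \<le> 3 * norm s / (real n)\<^sup>2" if "x \<in> ?S" for x
  proof -
    have "norm (g x - g (real n)) \<le> 3 * (x - real n) * (norm s / (real n)\<^sup>2)"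
      by (rule norm_diff_le_of_vector_derivative[OF dg bound that]) auto
    also have "\<dots> \<le> 3 * 1 * (norm s / (real n)\<^sup>2)"
      using that by (intro mult_right_mono mult_left_mono) auto
    finally show ?thesis by simp
  qed
  have "norm (G (real (Suc n)) - G (real n) - (real (Suc n) - real n) *\<^sub>R g (real n))
      \<le> norm (real (Suc n) - real n) * (3 * norm s / (real n)\<^sup>2)"
    by (rule vector_differentiable_bound_linearization[OF dG _ d]) (auto simp: closed_segment_eq_real_ivl)
  moreover have "g (real n) = npow s n" by (simp add: g_def npow_def)
  ultimately show ?thesis by (simp add: norm_minus_commute)
qed

lemma summable_inverse_square: "summable (\<lambda>n. 1 / (real n)\<^sup>2)"
  using inverse_power_summable[of 2, where 'a=real] by (simp add: divide_inverse)

text \<open>The increments of \<open>G\<close> telescope and \<open>G\<close> is bounded for Re s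
  \<ge> 1. The bound is uniform in N and stays finite as Re s tends to 1 with Im s fixed and
  nonzero; it stands in for the analytic continuation of zeta.\<close>

lemma norm_sum_npow_le:
  assumes s: "s \<noteq> 1" "1 \<le> Re s"
  shows "norm (\<Sum>n=1..N. npow s n) \<le> 2 / norm (1 - s) + 3 * norm s * (\<Sum>n. 1 / (real n)\<^sup>2)"
proof -
  define G where "G x = exp ((1 - s) * of_real (ln x)) / (1 - s)" for x :: real
  have G: "norm (G x) \<le> 1 / norm (1 - s)" if "1 \<le> x" for x
    using s that unfolding G_def norm_divide by (intro divide_right_mono) (auto intro: mult_nonpos_nonneg)
  have "(\<Sum>n=1..N. npow s n) = (\<Sum>n=1..N. npow s n - (G (real (Suc n)) - G (real n))) + (\<Sum>n=1..N. G (real (Suc n)) - G (real n))"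
    by (simp add: sum_subtractf sum.distrib)
  also have "(\<Sum>n=1..N. G (real (Suc n)) - G (real n)) = G (real (Suc N)) - G 1"
    by (induction N) auto
  also have "norm ((\<Sum>n=1..N. npow s n - (G (real (Suc n)) - G (real n))) + (G (real (Suc N)) - G 1))
     \<le> (\<Sum>n=1..N. 3 * norm s * (1 / (real n)\<^sup>2)) + (1 / norm (1 - s) + 1 / norm (1 - s))"
  proof (intro norm_triangle_le add_mono)
    show "norm (\<Sum>n=1..N. npow s n - (G (real (Suc n)) - G (real n))) \<le> (\<Sum>n=1..N. 3 * norm s * (1 / (real n)\<^sup>2))"
      using npow_minus_integral_le[OF s] unfolding G_def by (intro sum_norm_le) auto
    show "norm (G (real (Suc N)) - G 1) \<le> 1 / norm (1 - s) + 1 / norm (1 - s)"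
      by (intro order.trans[OF norm_triangle_ineq4] add_mono G) auto
  qed
  also have "(\<Sum>n=1..N. 3 * norm s * (1 / (real n)\<^sup>2)) \<le> 3 * norm s * (\<Sum>n. 1 / (real n)\<^sup>2)"
    unfolding sum_distrib_left[symmetric]
    by (intro mult_left_mono sum_le_suminf summable_inverse_square) auto
  finally show ?thesis by simp
qed

section \<open>Finite Euler products by sieving\<close>

lemma abs_summable_npow:
  assumes "1 < Re s" "A \<subseteq> {1..}"
  shows "(\<lambda>n. norm (npow s n)) summable_on A"
proof (rule summable_on_subset_banach[OF _ assms(2)])
  have "summable (\<lambda>n. real n powr (- Re s))" using assms by (simp add: summable_real_powr_iff)
  then have "(\<lambda>n. real n powr (- Re s)) summable_on UNIV"
    by (intro norm_summable_imp_summable_on) auto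
  then have "(\<lambda>n. real n powr (- Re s)) summable_on {1..}" by (rule summable_on_subset_banach) auto
  then show "(\<lambda>n. norm (npow s n)) summable_on {1..}"
    by (rule summable_on_cong[THEN iffD1, rotated]) (auto simp: norm_npow)
qed

definition rough :: "nat \<Rightarrow> nat set" where
  "rough k = {n. 1 \<le> n \<and> (\<forall>p. prime p \<and> p dvd n \<longrightarrow> k \<le> p)}"

text \<open>The sieve of Eratosthenes: for prime k, the members of \<open>rough k\<close> divisible
  by k are k times the members of \<open>rough k\<close>, so sieving by k multiplies the sum by 1 -
  k^(-s). The Euler product remains finite throughout.\<close>

lemma infsum_npow_rough:
  assumes s: "1 < Re s"
  shows "infsum (npow s) (rough k) = infsum (npow s) {1..} * (\<Prod>p\<in>{p\<in>{..<k}. prime p}. 1 - npow s p)"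
proof (induction k)
  case 0
  have "rough 0 = {1..}" by (auto simp: rough_def)
  then show ?case by simp
next
  case (Suc k)
  have sub: "rough j \<subseteq> {1..}" for j by (auto simp: rough_def)
  have sm: "npow s summable_on rough j" for j
    using abs_summable_npow[OF s sub] by (rule abs_summable_summable)
  show ?case
  proof (cases "prime k")
    case False
    have "rough (Suc k) = rough k"
      using False by (auto simp: rough_def Suc_le_eq) (metis le_neq_implies_less)
    moreover have "{p\<in>{..<Suc k}. prime p} = {p\<in>{..<k}. prime p}" using False by (auto simp: less_Suc_eq)
    ultimately show ?thesis using Suc by simp
  next
    case True
    then have k: "0 < k" by (rule prime_gt_0_nat)
    have "rough k - rough (Suc k) = (\<lambda>n. k * n) ` rough k"
    proof (intro set_eqI iffI)
      fix n assume n: "n \<in> rough k - rough (Suc k)"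
      then obtain p where p: "prime p" "p dvd n" "\<not> Suc k \<le> p" by (auto simp: rough_def)
      then have "p = k" using n by (auto simp: rough_def not_less_eq_eq intro: le_antisym)
      then obtain m where m: "n = k * m" using p by blast
      then have "m \<in> rough k" using n by (auto simp: rough_def intro: Suc_leI Nat.gr0I)
      then show "n \<in> (\<lambda>n. k * n) ` rough k" using m by blast
    next
      fix n assume "n \<in> (\<lambda>n. k * n) ` rough k"
      then obtain m where m: "n = k * m" "m \<in> rough k" by blast
      have "n \<in> rough k" using m k True by (auto simp: rough_def prime_dvd_mult_iff dest: primes_dvd_imp_eq)
      moreover have "n \<notin> rough (Suc k)" using m True by (auto simp: rough_def)
      ultimately show "n \<in> rough k - rough (Suc k)" by blast
    qed
    moreover have subs: "rough (Suc k) \<subseteq> rough k" by (auto simp: rough_def)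
    ultimately have "infsum (npow s) (rough k) - infsum (npow s) (rough (Suc k)) = infsum (npow s) ((\<lambda>n. k * n) ` rough k)"
      by (metis infsum_Diff sm)
    also have "\<dots> = infsum (npow s \<circ> (\<lambda>n. k * n)) (rough k)"
      using k by (intro infsum_reindex) (auto simp: inj_on_def)
    also have "\<dots> = infsum (\<lambda>n. npow s k * npow s n) (rough k)"
      using k by (intro infsum_cong) (auto simp: npow_mult rough_def)
    also have "\<dots> = npow s k * infsum (npow s) (rough k)" by (rule infsum_cmult_right')
    finally have "infsum (npow s) (rough (Suc k)) = infsum (npow s) (rough k) * (1 - npow s k)"
      by (simp add: algebra_simps)
    moreover have "{p\<in>{..<Suc k}. prime p} = insert k {p\<in>{..<k}. prime p}" using True by (auto simp: less_Suc_eq)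
    ultimately show ?thesis using Suc by (simp add: mult_ac)
  qed
qed

text \<open>Apart from 1, every member of \<open>rough k\<close> is at least k, so the sum is 1 plus
  part of the tail of a convergent series. This bounds |zeta(s)| times the finite product from
  below.\<close>

lemma eventually_norm_infsum_npow_rough_ge:
  assumes s: "1 < Re s"
  shows "eventually (\<lambda>k. 1 / 2 \<le> norm (infsum (npow s) (rough k))) sequentially"
proof -
  have sm: "summable (\<lambda>n. real n powr (- Re s))" using s by (simp add: summable_real_powr_iff)
  then obtain K where K: "norm (\<Sum>n. real (n + K) powr (- Re s)) < 1 / 2"
    using suminf_exist_split[of "1/2"] by force
  have "1 / 2 \<le> norm (infsum (npow s) (rough k))" if k: "max K 2 \<le> k" for k
  proof -
    define A where "A = rough k - {1}"
    have A: "A \<subseteq> {K..}"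
    proof
      fix n assume n: "n \<in> A"
      then obtain p where p: "prime p" "p dvd n" using prime_factor_nat[of n] by (auto simp: A_def)
      then have "k \<le> p" using n by (auto simp: A_def rough_def)
      also have "p \<le> n" using p n by (intro dvd_imp_le) (auto simp: A_def rough_def)
      finally show "n \<in> {K..}" using k by simp
    qed
    have A1: "A \<subseteq> {1..}" by (auto simp: A_def rough_def)
    have smA: "(\<lambda>n. norm (npow s n)) summable_on A" by (rule abs_summable_npow[OF s A1])
    have ins: "rough k = insert 1 A" by (auto simp: A_def rough_def)
    have "1 \<notin> A" by (simp add: A_def)
    then have eq: "infsum (npow s) (rough k) = 1 + infsum (npow s) A"
      unfolding ins using smA by (subst infsum_insert) (auto intro: abs_summable_summable)
    have "norm (infsum (npow s) A) \<le> infsum (\<lambda>n. norm (npow s n)) A"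
      by (rule norm_infsum_bound) (rule smA)
    also have "\<dots> = infsum (\<lambda>n. real n powr (- Re s)) A"
      using A1 by (intro infsum_cong) (auto simp: norm_npow subset_iff Suc_le_eq)
    also have "\<dots> \<le> infsum (\<lambda>n. real n powr (- Re s)) {K..}"
    proof (rule infsum_mono2)
      have "(\<lambda>n. real n powr (- Re s)) summable_on UNIV"
        using sm by (intro norm_summable_imp_summable_on) auto
      then show "(\<lambda>n. real n powr (- Re s)) summable_on A" "(\<lambda>n. real n powr (- Re s)) summable_on {K..}"
        by (rule summable_on_subset_banach; simp)+
    qed (use A in auto)
    also have "{K..} = range (\<lambda>n. n + K)"
      by (auto simp: le_iff_add add.commute image_iff)
    also have "infsum (\<lambda>n. real n powr (- Re s)) (range (\<lambda>n. n + K)) = infsum (\<lambda>n. real (n + K) powr (- Re s)) UNIV"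
      by (subst infsum_reindex) (auto simp: o_def)
    also have "\<dots> = (\<Sum>n. real (n + K) powr (- Re s))"
      using sm by (intro sums_unique has_sum_imp_sums has_sum_infsum norm_summable_imp_summable_on)
        (use summable_ignore_initial_segment[OF sm, of K] in \<open>simp del: of_nat_add\<close>)
    also have "\<dots> < 1 / 2" using K by simp
    finally show ?thesis
      unfolding eq using norm_triangle_ineq2[of "1::complex" "- infsum (npow s) A"] by simp
  qed
  then show ?thesis unfolding eventually_sequentially by blast
qed

text \<open>Apply 1 + u \<le> exp u to |1 - z|^2. For Euler factors this takes the place of a
  complex logarithm.\<close>

lemma norm_one_minus_le_exp: "norm (1 - z) \<le> exp (- Re z + (norm z)\<^sup>2 / 2)" for z :: complex
proof -
  have "(norm (1 - z))\<^sup>2 = 1 + (- 2 * Re z + (norm z)\<^sup>2)"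
    unfolding cmod_power2 by (simp add: power2_eq_square algebra_simps)
  also have "\<dots> \<le> exp (- 2 * Re z + (norm z)\<^sup>2)" by (rule exp_ge_add_one_self)
  also have "\<dots> = (exp (- Re z + (norm z)\<^sup>2 / 2))\<^sup>2" by (simp flip: exp_double add: algebra_simps)
  finally show ?thesis by (rule power2_le_imp_le) simp
qed

text \<open>Only the upper bound for \<open>Re (log \<zeta>)\<close> near \<open>1 + it\<close> is used, so the non-vanishing of \<open>\<zeta>\<close> on this
  line is not an issue.\<close>

lemma sum_cos_ln_primes_bounded_above:
  assumes t: "t \<noteq> 0"
  obtains C where "\<And>\<sigma>. 0 < \<sigma> \<Longrightarrow> \<sigma> \<le> 1 \<Longrightarrow>
    eventually (\<lambda>k. (\<Sum>p\<in>{p\<in>{..<k}. prime p}. real p powr (-1-\<sigma>) * cos (t * ln (real p))) \<le> C) sequentially"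
proof
  define Q where "Q = (\<Sum>n. 1 / (real n)\<^sup>2)"
  \<comment> \<open>For 0 < \<sigma> \<le> 1 the distance of s from the pole 1 is at least |t|, and
    |s| \<le> 2 + |t|; so C bounds the partial sums uniformly in \<sigma>.\<close>
  define C where "C = 2 / \<bar>t\<bar> + 3 * (2 + \<bar>t\<bar>) * Q"
  have Q0: "0 \<le> Q" unfolding Q_def by (intro suminf_nonneg summable_inverse_square) auto
  fix \<sigma> :: real assume \<sigma>: "0 < \<sigma>" "\<sigma> \<le> 1"
  define s where "s = Complex (1 + \<sigma>) t"
  have s: "1 < Re s" "s \<noteq> 1" using \<sigma> by (auto simp: s_def complex_eq_iff)
  have C0: "0 < C" using t Q0 by (auto simp: C_def intro!: add_pos_nonneg)
  have "norm (\<Sum>n=1..N. npow s n) \<le> C" for N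
  proof -
    have "\<bar>t\<bar> \<le> norm (1 - s)" using abs_Im_le_cmod[of "1 - s"] by (simp add: s_def)
    moreover have "norm s \<le> 2 + \<bar>t\<bar>" using cmod_le[of s] \<sigma> by (simp add: s_def)
    ultimately have "2 / norm (1 - s) + 3 * norm s * Q \<le> C"
      unfolding C_def using t Q0 s by (intro add_mono divide_left_mono mult_right_mono mult_left_mono) auto
    then show ?thesis using norm_sum_npow_le[of s N] s unfolding Q_def by simp
  qed
  moreover have "(\<lambda>N. \<Sum>n=1..N. npow s n) \<longlonglongrightarrow> infsum (npow s) {1..}"
  proof -
    have "npow s summable_on {1..}"
      using abs_summable_npow[OF s(1) order.refl] by (rule abs_summable_summable)
    moreover have r: "{1..} = range Suc" by (auto simp: image_iff Suc_le_eq gr0_conv_Suc)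
    ultimately have "((npow s \<circ> Suc) has_sum infsum (npow s) {1..}) UNIV"
      unfolding r by (subst has_sum_reindex[symmetric]) auto
    then have "(\<lambda>n. npow s (Suc n)) sums infsum (npow s) {1..}"
      unfolding o_def by (rule has_sum_imp_sums)
    then have "(\<lambda>N. \<Sum>n<N. npow s (Suc n)) \<longlonglongrightarrow> infsum (npow s) {1..}" by (simp only: sums_def)
    moreover have "(\<Sum>n<N. npow s (Suc n)) = (\<Sum>n=1..N. npow s n)" for N
      by (rule sum.reindex_bij_witness[of _ "\<lambda>n. n - 1" Suc]) auto
    ultimately show ?thesis by simp
  qed
  ultimately have Z: "norm (infsum (npow s) {1..}) \<le> C"
    by (intro tendsto_upperbound[OF tendsto_norm]) auto
  show "eventually (\<lambda>k. (\<Sum>p\<in>{p\<in>{..<k}. prime p}. real p powr (-1-\<sigma>) * cos (t * ln (real p))) \<le> ln (2 * C) + Q / 2) sequentially"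
    using eventually_norm_infsum_npow_rough_ge[OF s(1)]
  proof eventually_elim
    case (elim k)
    define A where "A = {p\<in>{..<k}. prime p}"
    \<comment> \<open>Since |zeta(s)| \<le> C, the finite Euler product cannot be small, and taking
      logarithms bounds the sum of Re p^(-s) from above. The term Q/2 pays for the squares
      |p^(-s)|^2 \<le> 1/p^2.\<close>
    have "1 / 2 \<le> norm (infsum (npow s) {1..}) * (\<Prod>p\<in>A. norm (1 - npow s p))"
      using elim unfolding infsum_npow_rough[OF s(1)] A_def by (simp add: norm_mult prod_norm)
    also have "\<dots> \<le> C * (\<Prod>p\<in>A. exp (- Re (npow s p) + (norm (npow s p))\<^sup>2 / 2))"
      using C0 by (intro mult_mono Z prod_mono conjI norm_one_minus_le_exp prod_nonneg) auto
    also have "(\<Prod>p\<in>A. exp (- Re (npow s p) + (norm (npow s p))\<^sup>2 / 2)) = exp (- (\<Sum>p\<in>A. Re (npow s p)) + (\<Sum>p\<in>A. (norm (npow s p))\<^sup>2) / 2)"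
      by (simp add: exp_sum[symmetric] A_def sum.distrib sum_negf sum_subtractf sum_divide_distrib)
    also have "(\<Sum>p\<in>A. (norm (npow s p))\<^sup>2) \<le> Q"
    proof -
      have "(\<Sum>p\<in>A. (norm (npow s p))\<^sup>2) \<le> (\<Sum>p\<in>A. 1 / (real p)\<^sup>2)"
      proof (rule sum_mono)
        fix p assume "p \<in> A"
        then have p: "1 \<le> real p" "0 < p" by (auto simp: A_def prime_gt_0_nat Suc_le_eq)
        have "norm (npow s p) \<le> real p powr (- 1)" using p s by (simp only: norm_npow, intro powr_mono) auto
        also have "\<dots> = 1 / real p" using p by (simp add: powr_minus_divide)
        finally show "(norm (npow s p))\<^sup>2 \<le> 1 / (real p)\<^sup>2" by (simp flip: power_one_over add: power_mono)
      qed
      also have "\<dots> \<le> Q" unfolding Q_def by (intro sum_le_suminf summable_inverse_square) (auto simp: A_def)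
      finally show ?thesis .
    qed
    finally have "1 / 2 \<le> C * exp (- (\<Sum>p\<in>A. Re (npow s p)) + Q / 2)"
      using C0 by (simp add: mult_left_mono)
    then have "1 / 2 \<le> C * (exp (Q / 2) / exp (\<Sum>p\<in>A. Re (npow s p)))"
      by (simp only: exp_diff[symmetric]) (simp add: add.commute)
    then have "exp (\<Sum>p\<in>A. Re (npow s p)) \<le> 2 * C * exp (Q / 2)"
      by (simp add: field_simps)
    also have "\<dots> = exp (ln (2 * C) + Q / 2)" using C0 by (simp add: exp_add)
    finally have "(\<Sum>p\<in>A. Re (npow s p)) \<le> ln (2 * C) + Q / 2" by simp
    moreover have "(\<Sum>p\<in>A. Re (npow s p)) = (\<Sum>p\<in>A. real p powr (-1-\<sigma>) * cos (t * ln (real p)))"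
      by (intro sum.cong refl) (auto simp: A_def npow_def s_def Re_exp powr_def prime_gt_0_nat algebra_simps)
    ultimately show ?case by (simp add: A_def)
  qed
qed

text \<open>The window starting at jD has ln p < (j + 1) D, so its mass at least 1 for ln p / p
  becomes at least 1 / ((j + 1) D) for 1/p; the disjoint windows add up to a harmonic
  series.\<close>

lemma primes_inverse_not_summable: "\<not> (\<lambda>p. 1 / real p) summable_on {p. prime p}"
proof
  assume sm: "(\<lambda>p. 1 / real p) summable_on {p. prime p}"
  define C where "C = infsum (\<lambda>p. 1 / real p) {p. prime p}"
  obtain D where D: "0 < D" "\<And>u. 0 \<le> u \<Longrightarrow> 1 \<le> (\<Sum>p\<in>primes_ln_Ico u (u + D). ln (real p) / real p)"
    by (rule mertens_window) blast
  define W where "W j = primes_ln_Ico (real j * D) (real j * D + D)" for j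
  have W: "1 / D * (1 / real (Suc j)) \<le> (\<Sum>p\<in>W j. 1 / real p)" for j
  proof -
    have "1 \<le> (\<Sum>p\<in>W j. ln (real p) / real p)" unfolding W_def using D by (intro D) auto
    also have "\<dots> \<le> (\<Sum>p\<in>W j. (real (Suc j) * D) * (1 / real p))"
      by (rule sum_mono) (auto simp: W_def primes_ln_Ico_def field_simps intro!: divide_right_mono)
    also have "\<dots> = (real (Suc j) * D) * (\<Sum>p\<in>W j. 1 / real p)" by (simp only: sum_distrib_left)
    finally show ?thesis using D by (simp add: divide_le_eq mult_ac del: of_nat_Suc)
  qed
  have "(\<Sum>j<J. 1 / D * (1 / real (Suc j))) \<le> C" for J
  proof -
    have "(\<Sum>j<J. 1 / D * (1 / real (Suc j))) \<le> (\<Sum>j<J. \<Sum>p\<in>W j. 1 / real p)"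
      by (intro sum_mono W)
    also have "\<dots> = (\<Sum>p\<in>(\<Union>j<J. W j). 1 / real p)"
    proof (rule sum.UNION_disjoint[symmetric])
      show "\<forall>i\<in>{..<J}. \<forall>j\<in>{..<J}. i \<noteq> j \<longrightarrow> W i \<inter> W j = {}"
      proof (intro ballI impI)
        fix i j :: nat assume "i \<noteq> j"
        have *: "W i \<inter> W j = {}" if "i < j" for i j
        proof -
          have "real (Suc i) * D \<le> real j * D" using that D by (intro mult_right_mono) auto
          then show ?thesis by (auto simp: W_def primes_ln_Ico_def algebra_simps)
        qed
        show "W i \<inter> W j = {}" using *[of i j] *[of j i] \<open>i \<noteq> j\<close> by (cases "i < j") auto
      qed
    qed (auto simp: W_def)
    also have "\<dots> \<le> C" unfolding C_def
      by (intro finite_sum_le_infsum sm) (simp add: W_def, auto simp: W_def primes_ln_Ico_def)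
    finally show ?thesis .
  qed
  then have "summable (\<lambda>j. 1 / D * (1 / real (Suc j)))"
    using D by (intro summableI_nonneg_bounded) auto
  then have "summable (\<lambda>j. D * (1 / D * (1 / real (Suc j))))" by (rule summable_mult)
  then have "summable (\<lambda>j. 1 / real (Suc j))" using D by simp
  then show False using summable_Suc_iff[of "\<lambda>n. 1 / real n"] not_summable_harmonic[where 'a=real] 
    by (simp add: divide_inverse)
qed

section \<open>Almost periods of averages of coloured families\<close>

text \<open>The exceptional primes in \<open>pretends_invariant\<close> form such a set. The notion
  is also applied to indices of logarithmic blocks, which carry the same weight 1/m.\<close>

definition thin :: "nat set \<Rightarrow> bool" where
  "thin Q \<longleftrightarrow> (\<lambda>p. 1 / real p) summable_on Q"

lemma thin_subset: "thin Q \<Longrightarrow> Q' \<subseteq> Q \<Longrightarrow> thin Q'"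
  unfolding thin_def by (rule summable_on_subset_banach)

lemma thin_Union:
  assumes "finite A" "\<And>i. i \<in> A \<Longrightarrow> thin (Q i)"
  shows "thin (\<Union>i\<in>A. Q i)"
  using assms
proof (induction A rule: finite_induct)
  case (insert i A)
  have "thin (Q i \<union> ((\<Union>i\<in>A. Q i) - Q i))"
    using insert unfolding thin_def
    by (intro summable_on_Un_disjoint) (auto intro: summable_on_subset_banach)
  then show ?case by (simp add: Un_Diff_cancel)
qed (simp add: thin_def)



text \<open>Divergence in the finite form that feeds Turan-Kubilius, whose variance is small once
  the finite sum of 1/p is large.\<close>

lemma not_thin_obtain:
  assumes "\<not> thin Q"
  obtains B where "finite B" "B \<subseteq> Q" "C < (\<Sum>p\<in>B. 1 / real p)"
proof (rule ccontr)
  assume "\<not> thesis"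
  then have "\<And>B. finite B \<Longrightarrow> B \<subseteq> Q \<Longrightarrow> (\<Sum>p\<in>B. 1 / real p) \<le> C" using that by force
  then have "thin Q" unfolding thin_def
    by (intro nonneg_bdd_above_summable_on bdd_aboveI2[where M=C]) auto
  then show False using assms by simp
qed

lemma sum_le_of_thin:
  assumes "thin Q"
  obtains C where "\<And>B. finite B \<Longrightarrow> B \<subseteq> Q \<Longrightarrow> (\<Sum>p\<in>B. 1 / real p) \<le> C"
proof (rule that)
  show "(\<Sum>p\<in>B. 1 / real p) \<le> infsum (\<lambda>p. 1 / real p) Q" if "finite B" "B \<subseteq> Q" for B
    using that assms unfolding thin_def by (intro finite_sum_le_infsum) auto
qed

lemma primes_not_thin: "\<not> thin {p. prime p}"
  unfolding thin_def by (rule primes_inverse_not_summable)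

text \<open>The model is \<open>f n = h (S n y)\<close> with \<open>col p = S p\<close>: dilation by
  p composes h with \<open>S p\<close>, so it depends on the colour only. Closure under dilation
  matters because Turan-Kubilius passes from f to its dilates, to which the same periods must then
  apply.\<close>

locale coloured_family =
  fixes \<F> :: "(nat \<Rightarrow> complex) set" and col :: "nat \<Rightarrow> 'c"
  assumes norm_le: "f \<in> \<F> \<Longrightarrow> norm (f n) \<le> 1"
    and fincol: "finite (col ` {p. prime p})"
    and dilate_closed: "f \<in> \<F> \<Longrightarrow> prime p \<Longrightarrow> (\<lambda>n. f (p * n)) \<in> \<F>"
    and dilate_col: "f \<in> \<F> \<Longrightarrow> prime p \<Longrightarrow> prime q \<Longrightarrow> col p = col q \<Longrightarrow> 0 < n \<Longrightarrow> f (p * n) = f (q * n)"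
begin

definition class_of :: "nat \<Rightarrow> nat set" where
  "class_of q = {p. prime p \<and> col p = col q}"

lemma avg_dilate_eq:
  assumes "f \<in> \<F>" "prime q" "p \<in> class_of q"
  shows "avg (\<lambda>n. f (p * n)) x = avg (\<lambda>n. f (q * n)) x"
  unfolding avg_def using assms
  by (intro arg_cong2[where f = "(/)"] sum.cong refl dilate_col) (auto simp: class_of_def)

text \<open>As B lies in one colour class, all dilates have the same averages, and f is compared
  with a convex combination of shifts of one function. The error is e from Turan-Kubilius plus 3e
  for moving ln p to v p.\<close>

lemma eventually_avg_weights:
  assumes f: "f \<in> \<F>" and q: "prime q" and B: "finite B" "B \<subseteq> class_of q"
    and w: "\<And>p. p \<in> B \<Longrightarrow> 0 \<le> w p" "sum w B = 1" and small: "(\<Sum>p\<in>B. real p * (w p)\<^sup>2) < e\<^sup>2" "0 < e"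
    and v: "\<And>p. p \<in> B \<Longrightarrow> \<bar>ln (real p) - v p\<bar> \<le> e"
  shows "eventually (\<lambda>x. norm (avg f x - (\<Sum>p\<in>B. of_real (w p) * avg (\<lambda>n. f (q * n)) (x * exp (- v p)))) \<le> 4 * e) at_top"
proof -
  define h where "h n = f (q * n)" for n
  have h: "h \<in> \<F>" unfolding h_def by (rule dilate_closed[OF f q])
  have pr: "prime p" if "p \<in> B" for p using B that by (auto simp: class_of_def)
  have "eventually (\<lambda>x. norm (avg f x - (\<Sum>p\<in>B. of_real (w p) * avg (\<lambda>n. f (p * n)) (x / real p))) \<le> e) at_top"
    by (rule turan_kubilius[OF B(1) pr w(2) norm_le[OF f] small])
  moreover have "eventually (\<lambda>x. \<forall>p\<in>B. norm (avg h (x * exp (- ln (real p))) - avg h (x * exp (- v p))) \<le> 3 * e) at_top"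
    using B(1) v small by (intro eventually_ball_finite ballI eventually_avg_exp_diff_le norm_le[OF h]) force+
  ultimately show ?thesis
  proof eventually_elim
    case (elim x)
    have "norm ((\<Sum>p\<in>B. of_real (w p) * avg (\<lambda>n. f (p * n)) (x / real p)) - (\<Sum>p\<in>B. of_real (w p) * avg h (x * exp (- v p))))
      = norm (\<Sum>p\<in>B. of_real (w p) * (avg h (x * exp (- ln (real p))) - avg h (x * exp (- v p))))"
      unfolding sum_subtractf[symmetric] right_diff_distrib
    proof (intro arg_cong[where f = norm] sum.cong refl)
      fix p assume p: "p \<in> B"
      then have "exp (- ln (real p)) = 1 / real p" using pr[OF p] by (simp add: exp_minus prime_gt_0_nat divide_inverse)
      moreover have "avg (\<lambda>n. f (p * n)) (x / real p) = avg h (x / real p)"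
        unfolding h_def using B p by (intro avg_dilate_eq[OF f q]) auto
      ultimately show "of_real (w p) * avg (\<lambda>n. f (p * n)) (x / real p) - of_real (w p) * avg h (x * exp (- v p))
         = of_real (w p) * avg h (x * exp (- ln (real p))) - of_real (w p) * avg h (x * exp (- v p))"
        by simp
    qed
    also have "\<dots> \<le> (\<Sum>p\<in>B. w p * (3 * e))"
      using elim(2) w(1) by (intro sum_norm_le) (auto simp: norm_mult intro!: mult_left_mono)
    also have "\<dots> = 3 * e" using w(2) by (simp add: sum_distrib_right[symmetric])
    finally show ?case using norm_diff_triangle_le[OF elim(1)] unfolding h_def by fastforce
  qed
qed

text \<open>One s serves the whole family, so that it applies to f and to its dilates alike; the
  threshold for x may depend on f.\<close>

definition almost_period :: "real \<Rightarrow> real \<Rightarrow> bool" where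
  "almost_period e s \<longleftrightarrow> (\<forall>f\<in>\<F>. eventually (\<lambda>x. norm (avg f (x * exp s) - avg f x) \<le> e) at_top)"

definition period :: "real \<Rightarrow> bool" where
  "period s \<longleftrightarrow> (\<forall>e>0. almost_period e s)"

section \<open>The closed group of periods\<close>

lemma filterlim_times_exp: "filterlim (\<lambda>x. x * exp s) at_top (at_top :: real filter)"
  by (rule filterlim_at_top_mult_tendsto_pos[OF tendsto_const]) (auto simp: filterlim_ident)

lemma eventually_times_exp: "eventually P at_top \<Longrightarrow> eventually (\<lambda>x. P (x * exp s)) (at_top :: real filter)"
  by (rule eventually_compose_filterlim[OF _ filterlim_times_exp])

lemma almost_period_perturb:
  assumes "almost_period e s" "\<bar>s' - s\<bar> \<le> d" "0 < d"
  shows "almost_period (e + 3 * d) s'"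
  unfolding almost_period_def
proof
  fix f assume f: "f \<in> \<F>"
  have "eventually (\<lambda>x. norm (avg f (x * exp s) - avg f x) \<le> e) at_top"
    using assms(1) f by (simp add: almost_period_def)
  moreover have "eventually (\<lambda>x. norm (avg f (x * exp s') - avg f (x * exp s)) \<le> 3 * d) at_top"
    by (rule eventually_avg_exp_diff_le[OF norm_le[OF f] assms(2,3)])
  ultimately show "eventually (\<lambda>x. norm (avg f (x * exp s') - avg f x) \<le> e + 3 * d) at_top"
  proof eventually_elim
    case (elim x) then show ?case by (smt (verit, best) norm_diff_triangle_le)
  qed
qed

lemma almost_period_add:
  assumes "almost_period e s" "almost_period e' s'"
  shows "almost_period (e + e') (s + s')"
  unfolding almost_period_def
proof
  fix f assume f: "f \<in> \<F>"
  have 1: "eventually (\<lambda>x. norm (avg f (x * exp s) - avg f x) \<le> e) at_top"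
    "eventually (\<lambda>x. norm (avg f (x * exp s') - avg f x) \<le> e') at_top"
    using assms f by (simp_all add: almost_period_def)
  show "eventually (\<lambda>x. norm (avg f (x * exp (s + s')) - avg f x) \<le> e + e') at_top"
    using 1(2) eventually_times_exp[OF 1(1), of s']
  proof eventually_elim
    case (elim x) then show ?case
      by (simp add: exp_add mult_ac) (smt (verit, best) norm_diff_triangle_le)
  qed
qed

lemma almost_period_minus: "almost_period e s \<Longrightarrow> almost_period e (- s)"
  unfolding almost_period_def
proof
  fix f assume f: "f \<in> \<F>" and *: "\<forall>f\<in>\<F>. eventually (\<lambda>x. norm (avg f (x * exp s) - avg f x) \<le> e) at_top"
  from * f have "eventually (\<lambda>x. norm (avg f (x * exp s) - avg f x) \<le> e) at_top" by blast
  from eventually_times_exp[OF this, of "-s"]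
  show "eventually (\<lambda>x. norm (avg f (x * exp (-s)) - avg f x) \<le> e) at_top"
    by (simp add: mult.assoc exp_minus norm_minus_commute)
qed

lemma period_add: "period s \<Longrightarrow> period s' \<Longrightarrow> period (s + s')"
  unfolding period_def
proof (intro allI impI)
  fix e :: real assume "\<forall>e>0. almost_period e s" "\<forall>e>0. almost_period e s'" "0 < e"
  then show "almost_period e (s + s')" using almost_period_add[of "e/2" s "e/2" s'] by simp
qed

lemma period_minus: "period s \<Longrightarrow> period (- s)"
  unfolding period_def by (blast intro: almost_period_minus)

lemma period_0: "period 0"
  unfolding period_def almost_period_def by simp

lemma period_of_nat_mult: "period s \<Longrightarrow> period (real n * s)"
  by (induction n) (auto simp: period_0 distrib_right intro!: period_add)

lemma period_of_int_mult: assumes "period s" shows "period (real_of_int n * s)"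
  using period_of_nat_mult[OF assms, of "nat n"] period_minus[OF period_of_nat_mult[OF assms, of "nat (- n)"]]
  by (cases "0 \<le> n") auto

text \<open>More than closedness of the set of periods: almost periods with errors tending to 0
  converge to a genuine period, which allows a compactness argument.\<close>

lemma period_limit:
  assumes "s \<longlonglongrightarrow> l" "e \<longlonglongrightarrow> 0" "\<And>n. almost_period (e n) (s n)"
  shows "period l"
  unfolding period_def
proof (intro allI impI)
  fix d :: real assume d: "0 < d"
  have "eventually (\<lambda>n. \<bar>l - s n\<bar> < d / 6) sequentially"
    using assms(1) d by (auto simp: tendsto_iff dist_real_def abs_minus_commute dest: spec[of _ "d/6"])
  moreover have "eventually (\<lambda>n. e n < d / 2) sequentially" using assms(2) d by (intro order_tendstoD) auto
  ultimately obtain n where n: "\<bar>l - s n\<bar> < d / 6" "e n < d / 2"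
    using eventually_happens[OF eventually_conj] by fastforce
  have "almost_period (e n + 3 * (d / 6)) l" using n d assms(3)[of n] by (intro almost_period_perturb) auto
  then show "almost_period d l" unfolding almost_period_def
    using n by (auto elim!: ballE eventually_mono)
qed



end

section \<open>Existence of a period\<close>

lemma sum_UN_le:
  fixes f :: "'a \<Rightarrow> real"
  assumes "finite A" "\<And>i. i \<in> A \<Longrightarrow> finite (B i)" "\<And>i x. i \<in> A \<Longrightarrow> x \<in> B i \<Longrightarrow> 0 \<le> f x"
  shows "sum f (\<Union>i\<in>A. B i) \<le> (\<Sum>i\<in>A. sum f (B i))"
  using assms
proof (induction A rule: finite_induct)
  case (insert i A)
  then have "sum f (B i \<union> (\<Union>i\<in>A. B i)) = sum f (B i) + sum f (\<Union>i\<in>A. B i) - sum f (B i \<inter> (\<Union>i\<in>A. B i))"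
    by (intro sum_Un) auto
  moreover have "0 \<le> sum f (B i \<inter> (\<Union>i\<in>A. B i))" using insert by (intro sum_nonneg) auto
  moreover have "sum f (\<Union>i\<in>A. B i) \<le> (\<Sum>i\<in>A. sum f (B i))" using insert by auto
  ultimately show ?case using insert by simp
qed simp

context coloured_family
begin

text \<open>Inside a cell the weight is spread proportionally to 1/p, which minimises the variance
  term for a prescribed total; a cell of total \<alpha> and mass S then contributes \<alpha>^2 / S.
  All primes of the cell share the shift \<open>v m\<close>.\<close>

lemma eventually_avg_cells:
  assumes f: "f \<in> \<F>" and q: "prime q" and M: "finite M"
    and C: "\<And>m. m \<in> M \<Longrightarrow> finite (C m)" "\<And>m. m \<in> M \<Longrightarrow> C m \<subseteq> class_of q"
    and disj: "\<And>m m'. m \<in> M \<Longrightarrow> m' \<in> M \<Longrightarrow> m \<noteq> m' \<Longrightarrow> C m \<inter> C m' = {}"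
    and \<alpha>: "\<And>m. m \<in> M \<Longrightarrow> 0 \<le> \<alpha> m" "sum \<alpha> M = 1"
    and pos: "\<And>m. m \<in> M \<Longrightarrow> 0 < (\<Sum>p\<in>C m. 1 / real p)"
    and small: "(\<Sum>m\<in>M. (\<alpha> m)\<^sup>2 / (\<Sum>p\<in>C m. 1 / real p)) < e\<^sup>2" "0 < e"
    and v: "\<And>m p. m \<in> M \<Longrightarrow> p \<in> C m \<Longrightarrow> \<bar>ln (real p) - v m\<bar> \<le> e"
  shows "eventually (\<lambda>x. norm (avg f x - (\<Sum>m\<in>M. of_real (\<alpha> m) * avg (\<lambda>n. f (q * n)) (x * exp (- v m)))) \<le> 4 * e) at_top"
proof -
  define S where "S m = (\<Sum>p\<in>C m. 1 / real p)" for m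
  define i where "i p = (THE m. m \<in> M \<and> p \<in> C m)" for p
  define w where "w p = \<alpha> (i p) / (real p * S (i p))" for p
  define B where "B = (\<Union>m\<in>M. C m)"
  have i: "i p = m" if "m \<in> M" "p \<in> C m" for m p
    unfolding i_def using that disj by blast
  have p0: "0 < p" if "m \<in> M" "p \<in> C m" for m p
    using C(2)[OF that(1)] that by (auto simp: class_of_def prime_gt_0_nat)
  have UN: "(\<Sum>p\<in>B. g p) = (\<Sum>m\<in>M. \<Sum>p\<in>C m. g p)" for g :: "nat \<Rightarrow> 'x::comm_monoid_add"
    unfolding B_def using M C disj by (intro sum.UNION_disjoint) auto
  have S: "0 < S m" if "m \<in> M" for m using pos[OF that] by (simp add: S_def)
  have wC: "(\<Sum>p\<in>C m. w p) = \<alpha> m" if "m \<in> M" for m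
  proof -
    have "(\<Sum>p\<in>C m. w p) = (\<Sum>p\<in>C m. \<alpha> m / S m * (1 / real p))"
      by (intro sum.cong refl) (simp add: w_def i[OF that])
    also have "\<dots> = \<alpha> m / S m * S m" unfolding S_def by (simp only: sum_distrib_left)
    finally show ?thesis using S[OF that] by simp
  qed
  have "eventually (\<lambda>x. norm (avg f x - (\<Sum>p\<in>B. of_real (w p) * avg (\<lambda>n. f (q * n)) (x * exp (- v (i p))))) \<le> 4 * e) at_top"
  proof (rule eventually_avg_weights[OF f q])
    show "finite B" "B \<subseteq> class_of q" using M C by (auto simp: B_def)
    show "0 \<le> w p" if "p \<in> B" for p
      using that \<alpha>(1) less_imp_le[OF S] i unfolding w_def B_def
      by (auto intro!: divide_nonneg_nonneg mult_nonneg_nonneg)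
    show "sum w B = 1" unfolding UN using \<alpha>(2) by (simp add: wC)
    have "(\<Sum>p\<in>C m. real p * (w p)\<^sup>2) = (\<alpha> m)\<^sup>2 / S m" if "m \<in> M" for m
    proof -
      have "(\<Sum>p\<in>C m. real p * (w p)\<^sup>2) = (\<Sum>p\<in>C m. \<alpha> m / S m * w p)"
      proof (intro sum.cong refl)
        fix p assume p: "p \<in> C m"
        show "real p * (w p)\<^sup>2 = \<alpha> m / S m * w p"
          using p0[OF that p] by (simp add: w_def i[OF that p] power2_eq_square)
      qed
      also have "\<dots> = \<alpha> m / S m * \<alpha> m" by (simp only: sum_distrib_left[symmetric] wC[OF that])
      finally show ?thesis by (simp add: power2_eq_square)
    qed
    then show "(\<Sum>p\<in>B. real p * (w p)\<^sup>2) < e\<^sup>2" unfolding UN using small by (simp add: S_def)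
    show "\<bar>ln (real p) - v (i p)\<bar> \<le> e" if "p \<in> B" for p
      using that v i by (auto simp: B_def)
  qed (use small in auto)
  moreover have "(\<Sum>p\<in>B. of_real (w p) * avg (\<lambda>n. f (q * n)) (x * exp (- v (i p))))
    = (\<Sum>m\<in>M. of_real (\<alpha> m) * avg (\<lambda>n. f (q * n)) (x * exp (- v m)))" for x
    unfolding UN
  proof (intro sum.cong refl)
    fix m assume m: "m \<in> M"
    have "(\<Sum>p\<in>C m. of_real (w p) * avg (\<lambda>n. f (q * n)) (x * exp (- v (i p))))
      = (\<Sum>p\<in>C m. of_real (w p)) * avg (\<lambda>n. f (q * n)) (x * exp (- v m))"
      unfolding sum_distrib_right by (intro sum.cong refl) (simp add: i[OF m])
    also have "(\<Sum>p\<in>C m. of_real (w p)) = (of_real (\<alpha> m) :: complex)"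
      unfolding wC[OF m, symmetric] by simp
    finally show "(\<Sum>p\<in>C m. of_real (w p) * avg (\<lambda>n. f (q * n)) (x * exp (- v (i p))))
      = of_real (\<alpha> m) * avg (\<lambda>n. f (q * n)) (x * exp (- v m))" .
  qed
  ultimately show ?thesis by simp
qed

lemma not_thin_positive: "\<not> thin {1..}"
proof
  assume "thin {1..}"
  then have "(\<lambda>n. 1 / real n) summable_on range Suc"
    unfolding thin_def by (rule summable_on_subset_banach) auto
  then have "((\<lambda>n. 1 / real n) \<circ> Suc) summable_on UNIV"
    by (subst summable_on_reindex[symmetric]) auto
  then have "summable (\<lambda>n. 1 / real (Suc n))"
    unfolding o_def by (rule sums_summable[OF has_sum_imp_sums[OF has_sum_infsum]])
  then show False using summable_Suc_iff[of "\<lambda>n. 1 / real n"] not_summable_harmonic[where 'a=real]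
    by (simp add: divide_inverse)
qed

text \<open>By Mertens' bound some cell of bounded logarithmic length in each of \<open>d + 1\<close> consecutive windows
  carries a positive proportion of the mass of one colour; two of these cells share their colour.\<close>

lemma exists_rich_cells:
  assumes D: "\<And>u. 0 \<le> u \<Longrightarrow> 1 \<le> (\<Sum>p\<in>primes_ln_Ico u (u + D). ln (real p) / real p)" "0 < D"
    and W: "0 < W"
  defines "d \<equiv> card (col ` {p. prime p})" and "\<delta> \<equiv> D / real W"
  defines "mass \<equiv> \<lambda>r c. \<Sum>p\<in>{p\<in>primes_ln_Ico (\<delta> * real r) (\<delta> * real r + \<delta>). col p = c}. ln (real p) / real p"
  shows "\<exists>c\<in>col ` {p. prime p}. \<exists>a a'. a + W \<le> a' \<and> a' < 2 * W * Suc d \<and>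
    1 / (real W * real d) \<le> mass (r + a) c \<and> 1 / (real W * real d) \<le> mass (r + a') c"
proof -
  define I where "I = col ` {p. prime p}"
  have fI: "finite I" unfolding I_def by (rule fincol)
  have "col 2 \<in> I" by (auto simp: I_def intro!: imageI)
  then have d: "0 < d" using fI unfolding d_def I_def[symmetric] by (auto simp: card_gt_0_iff)
  have \<delta>: "0 < \<delta>" "\<delta> * real W = D" using D W by (auto simp: \<delta>_def)
  \<comment> \<open>A window of length D is cut into W cells of length \<delta>, and its mass, at
    least 1, is shared by W * d pairs of a cell and a colour.\<close>
  have ex: "\<exists>k c. k < W \<and> c \<in> I \<and> 1 / (real W * real d) \<le> mass (r0 + k) c" for r0
  proof (rule ccontr)
    assume "\<not> ?thesis"
    then have less: "mass (r0 + k) c < 1 / (real W * real d)" if "k < W" "c \<in> I" for k c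
      using that by force
    have "1 \<le> (\<Sum>p\<in>primes_ln_Ico (\<delta> * real r0) (\<delta> * real r0 + D). ln (real p) / real p)"
      using \<delta> by (intro D) auto
    also have "\<dots> \<le> (\<Sum>p\<in>(\<Union>kc\<in>{..<W} \<times> I. {p\<in>primes_ln_Ico (\<delta> * real (r0 + fst kc)) (\<delta> * real (r0 + fst kc) + \<delta>). col p = snd kc}). ln (real p) / real p)"
    proof (rule sum_mono2)
      show "primes_ln_Ico (\<delta> * real r0) (\<delta> * real r0 + D) \<subseteq> (\<Union>kc\<in>{..<W} \<times> I. {p\<in>primes_ln_Ico (\<delta> * real (r0 + fst kc)) (\<delta> * real (r0 + fst kc) + \<delta>). col p = snd kc})"
      proof
        fix p assume p: "p \<in> primes_ln_Ico (\<delta> * real r0) (\<delta> * real r0 + D)"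
        define k where "k = nat \<lfloor>(ln (real p) - \<delta> * real r0) / \<delta>\<rfloor>"
        define y where "y = (ln (real p) - \<delta> * real r0) / \<delta>"
        have y: "0 \<le> y" "y < real W" using p \<delta> by (auto simp: y_def primes_ln_Ico_def divide_less_eq mult.commute)
        have k: "real k \<le> y" "y < real k + 1" using y unfolding k_def y_def[symmetric] by linarith+
        have "ln (real p) = \<delta> * real r0 + \<delta> * y" using \<delta> by (simp add: y_def)
        then have "p \<in> primes_ln_Ico (\<delta> * real (r0 + k)) (\<delta> * real (r0 + k) + \<delta>)"
          using p k \<delta> by (auto simp: primes_ln_Ico_def distrib_left) 
            (metis \<delta>(1) distrib_left mult.right_neutral mult_less_cancel_left_pos)
        moreover have "k < W" using k y by linarith
        moreover have "col p \<in> I" using p by (auto simp: I_def primes_ln_Ico_def)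
        ultimately show "p \<in> (\<Union>kc\<in>{..<W} \<times> I. {p\<in>primes_ln_Ico (\<delta> * real (r0 + fst kc)) (\<delta> * real (r0 + fst kc) + \<delta>). col p = snd kc})"
          by force
      qed
      show "finite (\<Union>kc\<in>{..<W} \<times> I. {p\<in>primes_ln_Ico (\<delta> * real (r0 + fst kc)) (\<delta> * real (r0 + fst kc) + \<delta>). col p = snd kc})"
        using fI by simp
    qed (auto simp: primes_ln_Ico_def Suc_le_eq prime_gt_0_nat intro!: divide_nonneg_nonneg)
    also have "\<dots> \<le> (\<Sum>kc\<in>{..<W} \<times> I. mass (r0 + fst kc) (snd kc))"
      unfolding mass_def
      by (intro sum_UN_le) (use fI in simp, simp, auto simp: primes_ln_Ico_def Suc_le_eq prime_gt_0_nat intro!: divide_nonneg_nonneg)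
    also have "\<dots> < (\<Sum>kc\<in>{..<W} \<times> I. 1 / (real W * real d))"
      using fI W \<open>col 2 \<in> I\<close> by (intro sum_strict_mono less) auto
    also have "\<dots> = 1" using W d by (simp add: card_cartesian_product d_def I_def)
    finally show False by simp
  qed
  \<comment> \<open>The windows start 2W cells apart although each has only W cells: cells from
    different windows are then at least W cells, hence D, apart.\<close>
  have "\<exists>k c. \<forall>j. k j < W \<and> c j \<in> I \<and> 1 / (real W * real d) \<le> mass (r + 2 * j * W + k j) (c j)"
    using ex[of "r + 2 * _ * W"] by (subst choice_iff[symmetric] | intro choice allI)+ blast
  then obtain k c where kc: "\<And>j. k j < W" "\<And>j. c j \<in> I" "\<And>j. 1 / (real W * real d) \<le> mass (r + 2 * j * W + k j) (c j)"
    by blast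
  have "\<not> inj_on c {..d}"
  proof
    assume "inj_on c {..d}"
    then have "card {..d} \<le> card I" using kc fI by (intro card_inj_on_le[of c]) auto
    then show False by (simp add: d_def I_def)
  qed
  then obtain j j' where j: "j \<le> d" "j' \<le> d" "j < j'" "c j = c j'"
    unfolding inj_on_def by (metis atMost_iff linorder_neqE_nat)
  have "2 * j * W + k j + W \<le> 2 * j' * W + k j'"
  proof -
    have "2 * Suc j * W \<le> 2 * j' * W" using j by (intro mult_le_mono) auto
    then show ?thesis using kc(1)[of j] by simp
  qed
  moreover have "2 * j' * W + k j' < 2 * W * Suc d"
  proof -
    have "2 * j' * W \<le> 2 * d * W" using j by (intro mult_le_mono) auto
    then have "2 * j' * W + k j' < 2 * d * W + 2 * W" using kc(1)[of j'] by linarith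
    then show ?thesis by (simp add: algebra_simps)
  qed
  ultimately show ?thesis
    using kc(2)[of j] kc(3)[of j] kc(3)[of j'] j unfolding I_def
    by (intro bexI[of _ "c j"] exI[of _ "2 * j * W + k j"] exI[of _ "2 * j' * W + k j'"]) (auto simp: add.assoc)
qed

text \<open>Cell m lies at logarithmic height at most 2 \<delta> L m, where mass \<kappa> of ln p /
  p amounts to mass at least \<kappa> / (2 \<delta> L m) of 1/p. Weights proportional to 1/m thus
  give variance at most 2 \<delta> L / (\<kappa> Z), with Z the sum of 1/m over M, and
  \<open>big\<close> makes this less than e^2. The weights do not depend on a, so two offsets can be
  compared.\<close>

lemma eventually_avg_near_cells:
  assumes f: "f \<in> \<F>" and q: "prime q" and \<delta>: "0 < \<delta>" and L: "0 < L" and a: "a < L" and e: "\<delta> \<le> e"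
    and M: "finite M" "M \<subseteq> {1..}" and \<kappa>: "0 < \<kappa>"
    and rich: "\<And>m. m \<in> M \<Longrightarrow> \<kappa> \<le> (\<Sum>p\<in>{p\<in>primes_ln_Ico (\<delta> * real (m * L + a)) (\<delta> * real (m * L + a) + \<delta>). col p = col q}. ln (real p) / real p)"
    and big: "2 * \<delta> * real L / (\<kappa> * e\<^sup>2) < (\<Sum>m\<in>M. 1 / real m)"
  shows "eventually (\<lambda>x. norm (avg f x - (\<Sum>m\<in>M. of_real (1 / real m / (\<Sum>m\<in>M. 1 / real m)) *
    avg (\<lambda>n. f (q * n)) (x * exp (- (\<delta> * real (m * L + a)))))) \<le> 4 * e) at_top"
proof -
  define Z where "Z = (\<Sum>m\<in>M. 1 / real m)"
  define C where "C m = {p\<in>primes_ln_Ico (\<delta> * real (m * L + a)) (\<delta> * real (m * L + a) + \<delta>). col p = col q}" for m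
  have e0: "0 < e" using \<delta> e by simp
  have Z0: "0 < Z" unfolding Z_def by (rule le_less_trans[OF _ big]) (use \<delta> \<kappa> in auto)
  have ZZ: "2 * \<delta> * real L / \<kappa> < e\<^sup>2 * Z" 
    using big e0 \<kappa> unfolding Z_def[symmetric] by (simp add: field_simps)
  have mass: "\<kappa> / (2 * \<delta> * real L) * (1 / real m) \<le> (\<Sum>p\<in>C m. 1 / real p)" if m: "m \<in> M" for m
  proof -
    have m1: "1 \<le> m" using M m by auto
    have "\<kappa> \<le> (\<Sum>p\<in>C m. ln (real p) / real p)" using rich[OF m] by (simp add: C_def)
    also have "\<dots> \<le> (\<Sum>p\<in>C m. (2 * \<delta> * real L * real m) * (1 / real p))"
    proof (rule sum_mono)
      fix p assume "p \<in> C m"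
      then have "ln (real p) \<le> \<delta> * real (m * L + a) + \<delta>" by (auto simp: C_def primes_ln_Ico_def)
      also have "\<dots> = \<delta> * real (m * L + Suc a)" by (simp add: algebra_simps)
      also have "m * L + Suc a \<le> 2 * L * m" using a m1 by (cases m) auto
      then have "\<delta> * real (m * L + Suc a) \<le> \<delta> * real (2 * L * m)" using \<delta> by (intro mult_left_mono) (simp_all only: of_nat_le_iff less_imp_le)
      finally have "ln (real p) \<le> 2 * \<delta> * real L * real m" by (simp add: mult_ac)
      then show "ln (real p) / real p \<le> (2 * \<delta> * real L * real m) * (1 / real p)"
        by (simp add: divide_right_mono)
    qed
    also have "\<dots> = (2 * \<delta> * real L * real m) * (\<Sum>p\<in>C m. 1 / real p)" by (simp only: sum_distrib_left)
    finally show ?thesis using \<delta> L m1 by (simp add: divide_le_eq mult_ac)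
  qed
  have pos: "0 < \<kappa> / (2 * \<delta> * real L) * (1 / real m)" if "m \<in> M" for m using \<delta> \<kappa> L M that by auto
  show ?thesis unfolding Z_def[symmetric]
  proof (rule eventually_avg_cells[OF f q M(1), where C = C])
    show "finite (C m)" "C m \<subseteq> class_of q" for m
      by (simp add: C_def) (auto simp: C_def class_of_def primes_ln_Ico_def)
    show "C m \<inter> C m' = {}" if "m \<noteq> m'" for m m'
    proof -
      have *: "C m \<inter> C m' = {}" if "m < m'" for m m'
      proof -
        have "Suc m * L \<le> m' * L" using that by (intro mult_le_mono) auto
        then have "m * L + a + 1 \<le> m' * L + a" using L by simp
        then have "real (m * L + a + 1) \<le> real (m' * L + a)" by (simp only: of_nat_le_iff)
        then have "\<delta> * real (m * L + a + 1) \<le> \<delta> * real (m' * L + a)" using \<delta> by (intro mult_left_mono) auto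
        then have "\<delta> * real (m * L + a) + \<delta> \<le> \<delta> * real (m' * L + a)" by (simp add: algebra_simps)
        then show ?thesis unfolding C_def primes_ln_Ico_def by fastforce
      qed
      then show ?thesis using that by (metis Int_commute linorder_neqE_nat)
    qed
    show "0 \<le> 1 / real m / Z" for m using Z0 by simp
    show "(\<Sum>m\<in>M. 1 / real m / Z) = 1" using Z0 unfolding sum_divide_distrib[symmetric] Z_def by simp
    show "0 < (\<Sum>p\<in>C m. 1 / real p)" if "m \<in> M" for m using mass[OF that] pos[OF that] by linarith
    have "(\<Sum>m\<in>M. (1 / real m / Z)\<^sup>2 / (\<Sum>p\<in>C m. 1 / real p)) \<le> (\<Sum>m\<in>M. (2 * \<delta> * real L / \<kappa> / Z\<^sup>2) * (1 / real m))"
    proof (rule sum_mono)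
      fix m assume m: "m \<in> M"
      have "(1 / real m / Z)\<^sup>2 / (\<Sum>p\<in>C m. 1 / real p) \<le> (1 / real m / Z)\<^sup>2 / (\<kappa> / (2 * \<delta> * real L) * (1 / real m))"
        by (rule divide_left_mono[OF mass[OF m] zero_le_power2 mult_pos_pos[OF less_le_trans[OF pos[OF m] mass[OF m]] pos[OF m]]])
      also have "\<dots> = (2 * \<delta> * real L / \<kappa> / Z\<^sup>2) * (1 / real m)"
        using m M by (auto simp: power2_eq_square field_simps)
      finally show "(1 / real m / Z)\<^sup>2 / (\<Sum>p\<in>C m. 1 / real p) \<le> (2 * \<delta> * real L / \<kappa> / Z\<^sup>2) * (1 / real m)" .
    qed
    also have "\<dots> = 2 * \<delta> * real L / \<kappa> / Z"
      unfolding sum_distrib_left[symmetric] Z_def[symmetric] using Z0 by (simp add: power2_eq_square)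
    also have "\<dots> < e\<^sup>2" using ZZ Z0 by (simp only: pos_divide_less_eq)
    finally show "(\<Sum>m\<in>M. (1 / real m / Z)\<^sup>2 / (\<Sum>p\<in>C m. 1 / real p)) < e\<^sup>2" .
    show "\<bar>ln (real p) - \<delta> * real (m * L + a)\<bar> \<le> e" if "p \<in> C m" for m p
      using that e by (auto simp: C_def primes_ln_Ico_def)
  qed (rule e0)
qed

text \<open>Every block m of L cells has a colour c and two rich offsets a, a'. There are finitely
  many patterns (c, a, a'), so one of them recurs on a set of m that is not thin, and s is the
  distance of its offsets. The bounds on s are independent of e, although \<delta> is not.\<close>

lemma exists_almost_period:
  obtains D L where "0 < D" "\<And>e. 0 < e \<Longrightarrow> \<exists>s\<in>{D..L}. almost_period e s"
proof -
  obtain D where D: "0 < D" "\<And>u. 0 \<le> u \<Longrightarrow> 1 \<le> (\<Sum>p\<in>primes_ln_Ico u (u + D). ln (real p) / real p)"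
    by (rule mertens_window) blast
  define d where "d = card (col ` {p. prime p})"
  have "col 2 \<in> col ` {p. prime p}" by (auto intro!: imageI)
  then have d: "0 < d" using fincol unfolding d_def by (auto simp: card_gt_0_iff)
  define I where "I = col ` {p. prime p}"
  have "\<exists>s\<in>{D..D * (2 * Suc d)}. almost_period \<epsilon> s" if \<epsilon>: "0 < \<epsilon>" for \<epsilon>
  proof -
    \<comment> \<open>Two comparisons will be made, each with error 4e.\<close>
    define e where "e = \<epsilon> / 8"
    have e: "0 < e" using \<epsilon> by (simp add: e_def)
    obtain W where "D / e < real W" using reals_Archimedean2 by blast
    then have less: "D < e * real W" using e by (simp add: field_simps)
    then have W: "0 < W" using D by (intro Nat.gr0I) auto
    then have W: "0 < W" "D / real W \<le> e" using less by (simp_all add: field_simps)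
    define \<delta> where "\<delta> = D / real W"
    define L where "L = 2 * W * Suc d"
    define \<kappa> where "\<kappa> = 1 / (real W * real d)"
    have \<delta>: "0 < \<delta>" "\<delta> \<le> e" "\<delta> * real W = D" using W D by (auto simp: \<delta>_def)
    have \<kappa>: "0 < \<kappa>" using W d by (simp add: \<kappa>_def)
    define rich where "rich m c a \<longleftrightarrow> \<kappa> \<le> (\<Sum>p\<in>{p\<in>primes_ln_Ico (\<delta> * real (m * L + a)) (\<delta> * real (m * L + a) + \<delta>). col p = c}. ln (real p) / real p)" for m c a
    define T where "T = I \<times> {..<L} \<times> {..<L}"
    define Q where "Q = (\<lambda>(c, a, a'). {m\<in>{1..}. a + W \<le> a' \<and> rich m c a \<and> rich m c a'})"
    have "finite T" unfolding T_def I_def using fincol by simp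
    moreover have "{1..} \<subseteq> (\<Union>\<tau>\<in>T. Q \<tau>)"
    proof
      fix m :: nat assume m: "m \<in> {1..}"
      have "\<exists>c\<in>I. \<exists>a a'. a + W \<le> a' \<and> a' < L \<and> rich m c a \<and> rich m c a'"
        using exists_rich_cells[OF D(2,1) W(1), of "m * L"]
        unfolding rich_def \<delta>_def \<kappa>_def L_def d_def I_def .
      then obtain c a a' where "c \<in> I" "a + W \<le> a'" "a' < L" "rich m c a" "rich m c a'" by auto
      then have "(c, a, a') \<in> T" "m \<in> Q (c, a, a')" using m by (auto simp: T_def Q_def)
      then show "m \<in> (\<Union>\<tau>\<in>T. Q \<tau>)" by blast
    qed
    ultimately obtain \<tau> where "\<tau> \<in> T" "\<not> thin (Q \<tau>)"
      using thin_subset not_thin_positive thin_Union by metis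
    then obtain c a a' where T: "c \<in> I" "a < L" "a' < L" and nt: "\<not> thin (Q (c, a, a'))"
      by (auto simp: T_def)
    obtain M where M: "finite M" "M \<subseteq> Q (c, a, a')" "2 * \<delta> * real L / (\<kappa> * e\<^sup>2) < (\<Sum>m\<in>M. 1 / real m)"
      by (rule not_thin_obtain[OF nt])
    have L0: "0 < L" using W by (simp add: L_def)
    have "0 < 2 * \<delta> * real L / (\<kappa> * e\<^sup>2)" using \<delta>(1) \<kappa> e L0 by simp
    then have "M \<noteq> {}" using M(3) by auto
    then have aa: "a + W \<le> a'" using M(2) by (auto simp: Q_def)
    obtain q where q: "prime q" "col q = c" using T by (auto simp: I_def)
    have M1: "M \<subseteq> {1..}" using M(2) by (auto simp: Q_def)
    define s where "s = \<delta> * (real a' - real a)"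
    have "almost_period \<epsilon> s"
      unfolding almost_period_def
    proof
      fix f assume f: "f \<in> \<F>"
      define G where "G b x = (\<Sum>m\<in>M. of_real (1 / real m / (\<Sum>m\<in>M. 1 / real m)) * avg (\<lambda>n. f (q * n)) (x * exp (- (\<delta> * real (m * L + b)))))" for b :: nat and x
      have *: "eventually (\<lambda>x. norm (avg f x - G b x) \<le> 4 * e) at_top" if "b = a \<or> b = a'" for b
        unfolding G_def
      proof (rule eventually_avg_near_cells[OF f q(1) \<delta>(1) L0 _ \<delta>(2) M(1) M1 \<kappa> _ M(3)])
        show "b < L" using T that by auto
        show "\<kappa> \<le> (\<Sum>p\<in>{p\<in>primes_ln_Ico (\<delta> * real (m * L + b)) (\<delta> * real (m * L + b) + \<delta>). col p = col q}. ln (real p) / real p)"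
          if "m \<in> M" for m
          using that M(2) \<open>b = a \<or> b = a'\<close> unfolding Q_def rich_def q by auto
      qed
      \<comment> \<open>The displacement s carries offset a' to offset a in every block at once; the
        unknown averages of the dilate cancel here.\<close>
      have G: "G a' (x * exp s) = G a x" for x
        unfolding G_def s_def by (simp add: mult.assoc exp_add[symmetric] algebra_simps)
      show "eventually (\<lambda>x. norm (avg f (x * exp s) - avg f x) \<le> \<epsilon>) at_top"
        using *[OF disjI1[OF refl]] eventually_times_exp[OF *[OF disjI2[OF refl]], of s]
      proof eventually_elim
        case (elim x)
        then have "norm (avg f (x * exp s) - G a x) \<le> 4 * e" "norm (G a x - avg f x) \<le> 4 * e"
          by (simp_all add: G norm_minus_commute)
        from norm_diff_triangle_le[OF this] show ?case by (simp add: e_def)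
      qed
    qed
    moreover have "D \<le> s"
      unfolding s_def \<delta>(3)[symmetric] using aa \<delta>(1) by (intro mult_left_mono) auto
    moreover have "s \<le> \<delta> * real L" unfolding s_def using T \<delta> by (intro mult_left_mono) auto
    then have "s \<le> D * (2 * Suc d)" unfolding L_def \<delta>(3)[symmetric] by (simp add: algebra_simps)
    ultimately show ?thesis by auto
  qed
  then show ?thesis using that D(1) by blast
qed

text \<open>Take a limit point of almost periods with shrinking error; the lower bound D keeps it
  away from 0.\<close>

lemma exists_positive_period: obtains s where "0 < s" "period s"
proof -
  obtain D L where D: "0 < D" "\<And>e. 0 < e \<Longrightarrow> \<exists>s\<in>{D..L}. almost_period e s"
    by (rule exists_almost_period) blast
  have "\<forall>n. \<exists>s\<in>{D..L}. almost_period (1 / real (Suc n)) s" using D by simp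
  then obtain s where s: "\<And>n. s n \<in> {D..L}" "\<And>n. almost_period (1 / real (Suc n)) (s n)" by metis
  obtain l r where lr: "l \<in> {D..L}" "strict_mono r" "(s \<circ> r) \<longlonglongrightarrow> l"
    using compact_Icc[of D L] s(1) unfolding compact_def by metis
  have "(\<lambda>n. 1 / real (Suc n)) \<longlonglongrightarrow> 0" using LIMSEQ_inverse_real_of_nat by (simp add: divide_inverse)
  then have "((\<lambda>n. 1 / real (Suc n)) \<circ> r) \<longlonglongrightarrow> 0" using lr(2) by (rule LIMSEQ_subseq_LIMSEQ)
  with lr(3) have "period l" by (rule period_limit) (simp add: s del: of_nat_Suc)
  then show ?thesis using that[of l] lr(1) D(1) by simp
qed

text \<open>Multiples of arbitrarily small periods approximate every t, and slow variation makes t a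
  period. Otherwise the infimum c of the positive periods is positive, a period by closedness, and a
  generator by division with remainder; the existence of a positive period excludes the trivial
  group.\<close>

lemma periods_dichotomy:
  obtains "\<And>s. period s" | c where "0 < c" "period c" "\<And>s. period s \<Longrightarrow> \<exists>k. s = of_int k * c"
proof (cases "\<forall>\<eta>>0. \<exists>s. 0 < s \<and> s < \<eta> \<and> period s")
  case True
  have "period t" for t
    unfolding period_def
  proof (intro allI impI)
    fix e :: real assume e: "0 < e"
    then obtain s where s: "0 < s" "s < e / 6" "period s" using True[rule_format, of "e / 6"] by auto
    define k where "k = \<lfloor>t / s\<rfloor>"
    have "of_int k * s \<le> t" "t < (of_int k + 1) * s"
      unfolding k_def using s floor_divide_lower[of s t] floor_divide_upper[of s t] by auto
    then have "\<bar>t - of_int k * s\<bar> \<le> e / 6" using s by (simp add: algebra_simps)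
    moreover have "almost_period (e / 2) (of_int k * s)"
      using period_of_int_mult[OF s(3), of k] e by (simp add: period_def)
    ultimately have "almost_period (e / 2 + 3 * (e / 6)) t" using e by (intro almost_period_perturb) auto
    then show "almost_period e t" by simp
  qed
  then show ?thesis using that by blast
next
  case False
  then obtain \<eta> where \<eta>: "0 < \<eta>" "\<And>s. 0 < s \<Longrightarrow> period s \<Longrightarrow> \<eta> \<le> s" by force
  define P where "P = {s. 0 < s \<and> period s}"
  define c where "c = Inf P"
  have ne: "P \<noteq> {}" using exists_positive_period unfolding P_def by blast
  have bdd: "bdd_below P" unfolding P_def by (intro bdd_belowI[of _ 0]) auto
  have "\<eta> \<le> c" unfolding c_def using ne \<eta> by (intro cInf_greatest) (auto simp: P_def)
  then have c0: "0 < c" using \<eta> by simp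
  have c_le: "c \<le> s" if "0 < s" "period s" for s
    unfolding c_def using that bdd by (intro cInf_lower) (auto simp: P_def)
  have "c \<in> closure P" unfolding c_def by (rule closure_contains_Inf[OF ne bdd])
  then obtain s where s: "\<And>n. s n \<in> P" "s \<longlonglongrightarrow> c" unfolding closure_sequential by blast
  have "(\<lambda>n. 1 / real (Suc n)) \<longlonglongrightarrow> 0" using LIMSEQ_inverse_real_of_nat by (simp add: divide_inverse)
  moreover have "almost_period (1 / real (Suc n)) (s n)" for n using s(1)[of n] by (simp add: P_def period_def)
  ultimately have "period c" by (rule period_limit[OF s(2)])
  moreover have "\<exists>k. s = of_int k * c" if s: "period s" for s
  proof
    define k where "k = \<lfloor>s / c\<rfloor>"
    have "of_int k * c \<le> s" "s < (of_int k + 1) * c"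
      unfolding k_def using c0 floor_divide_lower[of c s] floor_divide_upper[of c s] by auto
    then have b: "0 \<le> s - of_int k * c" "s - of_int k * c < c" by (auto simp: algebra_simps)
    have "period (s + - (of_int k * c))"
      by (intro period_add period_minus period_of_int_mult s \<open>period c\<close>)
    then have "\<not> 0 < s - of_int k * c" using c_le[of "s - of_int k * c"] b(2) by fastforce
    then show "s = of_int k * c" using b by linarith
  qed
  ultimately show ?thesis using that c0 by blast
qed

end

section \<open>All real numbers are periods\<close>

lemma cos_ge_half:
  assumes "\<bar>x - 2 * pi * of_int m\<bar> \<le> pi / 3"
  shows "1 / 2 \<le> cos x"
proof -
  define y where "y = \<bar>x - 2 * pi * of_int m\<bar>"
  have "cos (pi / 3) \<le> cos y" using assms pi_gt_zero unfolding y_def[symmetric]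
    by (intro cos_monotone_0_pi_le) (auto simp: y_def)
  also have "cos y = cos x"
    using cos_diff[of x "2 * pi * of_int m"] cos_int_2pin[of m] sin_int_2pin[of m] by (simp add: y_def)
  finally show ?thesis by (simp add: cos_60)
qed

text \<open>Otherwise \<open>\<Sum> cos (t log p) p\<^sup>-\<^sup>1\<^sup>-\<^sup>\<sigma>\<close> would be at least \<open>1/2 \<Sum> p\<^sup>-\<^sup>1\<^sup>-\<^sup>\<sigma> - O(1)\<close>, hence unbounded as \<open>\<sigma> \<rightarrow> 0\<close>.\<close>

lemma not_thin_cos_less_half:
  assumes t: "t \<noteq> 0"
  shows "\<not> thin {p. prime p \<and> cos (t * ln (real p)) < 1 / 2}" (is "\<not> thin ?bad")
proof
  assume thin: "thin ?bad"
  obtain E where E: "\<And>B. finite B \<Longrightarrow> B \<subseteq> ?bad \<Longrightarrow> (\<Sum>p\<in>B. 1 / real p) \<le> E"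
    using sum_le_of_thin[OF thin] by blast
  obtain C where C: "\<And>\<sigma>. 0 < \<sigma> \<Longrightarrow> \<sigma> \<le> 1 \<Longrightarrow>
    eventually (\<lambda>k. (\<Sum>p\<in>{p\<in>{..<k}. prime p}. real p powr (-1-\<sigma>) * cos (t * ln (real p))) \<le> C) sequentially"
    using sum_cos_ln_primes_bounded_above[OF t] by blast
  have le: "(\<Sum>p\<in>{p\<in>{..<K}. prime p}. real p powr (-1-\<sigma>)) \<le> 2 * C + 3 * E" if \<sigma>: "0 < \<sigma>" "\<sigma> \<le> 1" for \<sigma> K
  proof -
    obtain k where k: "K \<le> k" "(\<Sum>p\<in>{p\<in>{..<k}. prime p}. real p powr (-1-\<sigma>) * cos (t * ln (real p))) \<le> C"
      \<comment> \<open>The cosine sum is bounded only for large k, whereas the sum of the positive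
        terms b p increases with k; so a bound at some k \<ge> K settles K.\<close>
      using eventually_happens[OF eventually_conj[OF eventually_ge_at_top[of K] C[OF \<sigma>]]] by auto
    define A where "A = {p\<in>{..<k}. prime p}"
    define b where "b p = real p powr (-1-\<sigma>)" for p
    \<comment> \<open>On a bad prime, b - 3/p \<le> -2b \<le> 2b cos, because b \<le> 1/p; on the
      others cos \<ge> 1/2.\<close>
    have "(\<Sum>p\<in>A. b p - 3 * (if p \<in> ?bad then 1 / real p else 0)) \<le> (\<Sum>p\<in>A. 2 * (b p * cos (t * ln (real p))))"
    proof (rule sum_mono)
      fix p assume "p \<in> A"
      then have p: "prime p" "1 \<le> real p" by (auto simp: A_def Suc_le_eq prime_gt_0_nat)
      have b0: "0 \<le> b p" by (simp add: b_def)
      have "b p \<le> real p powr (-1)" unfolding b_def using p \<sigma> by (intro powr_mono) auto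
      then have b1: "b p \<le> 1 / real p" using p by (simp add: powr_minus_divide)
      show "b p - 3 * (if p \<in> ?bad then 1 / real p else 0) \<le> 2 * (b p * cos (t * ln (real p)))"
      proof (cases "p \<in> ?bad")
        case True
        have "b p * (-1) \<le> b p * cos (t * ln (real p))" by (intro mult_left_mono b0) simp
        then show ?thesis using True b1 by simp
      next
        case False
        have "b p * (1 / 2) \<le> b p * cos (t * ln (real p))" using p False by (intro mult_left_mono b0) auto
        then show ?thesis unfolding if_not_P[OF False] by simp
      qed
    qed
    also have "\<dots> \<le> 2 * C" using k(2) by (simp add: A_def b_def sum_distrib_left[symmetric])
    finally have "(\<Sum>p\<in>A. b p) - 3 * (\<Sum>p\<in>A. if p \<in> ?bad then 1 / real p else 0) \<le> 2 * C"
      by (simp only: sum_subtractf sum_distrib_left)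
    moreover have "(\<Sum>p\<in>A. if p \<in> ?bad then 1 / real p else 0) = (\<Sum>p\<in>{p\<in>A. p \<in> ?bad}. 1 / real p)"
      by (rule sum.inter_filter[symmetric]) (simp add: A_def)
    moreover have "\<dots> \<le> E" by (intro E) (auto simp: A_def)
    moreover have "(\<Sum>p\<in>{p\<in>{..<K}. prime p}. b p) \<le> (\<Sum>p\<in>A. b p)"
      using k(1) by (intro sum_mono2) (auto simp: A_def b_def)
    ultimately show ?thesis by (simp add: b_def)
  qed
  have "(\<Sum>p\<in>{p\<in>{..<K}. prime p}. 1 / real p) \<le> 2 * C + 3 * E" for K
  proof (rule tendsto_upperbound)
    have "((\<lambda>\<sigma>. \<Sum>p\<in>{p\<in>{..<K}. prime p}. real p powr (-1-\<sigma>)) \<longlongrightarrow> (\<Sum>p\<in>{p\<in>{..<K}. prime p}. real p powr (-1-0))) (at_right 0)"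
      by (intro tendsto_sum tendsto_powr tendsto_intros) (auto simp: prime_gt_0_nat)
    also have "(\<Sum>p\<in>{p\<in>{..<K}. prime p}. real p powr (-1-0)) = (\<Sum>p\<in>{p\<in>{..<K}. prime p}. 1 / real p)"
      by (intro sum.cong refl) (simp add: powr_minus_divide)
    finally show "((\<lambda>\<sigma>. \<Sum>p\<in>{p\<in>{..<K}. prime p}. real p powr (-1-\<sigma>)) \<longlongrightarrow> (\<Sum>p\<in>{p\<in>{..<K}. prime p}. 1 / real p)) (at_right 0)" .
    show "eventually (\<lambda>\<sigma>. (\<Sum>p\<in>{p\<in>{..<K}. prime p}. real p powr (-1-\<sigma>)) \<le> 2 * C + 3 * E) (at_right 0)"
      using eventually_at_right_real[OF zero_less_one] by (rule eventually_mono) (rule le; simp)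
  qed simp
  moreover obtain B where B: "finite B" "B \<subseteq> {p. prime p}" "2 * C + 3 * E < (\<Sum>p\<in>B. 1 / real p)"
    using not_thin_obtain[OF primes_not_thin] by blast
  moreover have "(\<Sum>p\<in>B. 1 / real p) \<le> (\<Sum>p\<in>{p\<in>{..<Suc (Max (insert 0 B))}. prime p}. 1 / real p)"
    using B by (intro sum_mono2) (auto simp: less_Suc_eq_le)
  ultimately show False by (meson not_le order.trans)
qed

text \<open>The open arc of radius e around a on the circle of reals modulo c, pulled back along the
  logarithm.\<close>

definition log_near :: "real \<Rightarrow> real \<Rightarrow> real \<Rightarrow> nat set" where
  "log_near c a e = {p. \<exists>k::int. \<bar>ln (real p) - a - of_int k * c\<bar> < e}"

lemma log_near_shift: "log_near c (a + of_int j * c) e = log_near c a e"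
proof -
  have "p \<in> log_near c a e" if p: "p \<in> log_near c (a + of_int j * c) e" for p a j
  proof -
    obtain k :: int where "\<bar>ln (real p) - (a + of_int j * c) - of_int k * c\<bar> < e"
      using p by (auto simp: log_near_def)
    then have "\<bar>ln (real p) - a - of_int (k + j) * c\<bar> < e" by (simp add: algebra_simps)
    then show ?thesis unfolding log_near_def by blast
  qed
  from this[of _ a j] this[of _ "a + of_int j * c" "- j"] show ?thesis by auto
qed

text \<open>Compactness of the circle modulo c: otherwise finitely many arcs with thin preimage in Q
  would cover it, and Q would be thin.\<close>

lemma not_thin_accumulation:
  assumes nt: "\<not> thin Q" and c: "0 < c"
  obtains a where "\<And>e. 0 < e \<Longrightarrow> \<not> thin (Q \<inter> log_near c a e)"
proof (rule ccontr)
  assume "\<not> thesis"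
  then have "\<forall>a. \<exists>e>0. thin (Q \<inter> log_near c a e)" using that by blast
  then obtain e where e: "\<And>a. 0 < e a" "\<And>a. thin (Q \<inter> log_near c a (e a))" by metis
  have "{0..c} \<subseteq> (\<Union>a\<in>UNIV. ball a (e a))" using e(1) by (auto intro: centre_in_ball[THEN iffD2])
  then obtain A where A: "finite A" "{0..c} \<subseteq> (\<Union>a\<in>A. ball a (e a))"
    using compactE_image[OF compact_Icc, of UNIV "\<lambda>a. ball a (e a)" 0 c] by auto
  have "Q \<subseteq> (\<Union>a\<in>A. Q \<inter> log_near c a (e a))"
  proof
    fix p assume p: "p \<in> Q"
    define k where "k = \<lfloor>ln (real p) / c\<rfloor>"
    have "of_int k * c \<le> ln (real p)" "ln (real p) < (of_int k + 1) * c"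
      unfolding k_def using c floor_divide_lower[of c] floor_divide_upper[of c] by auto
    then have "ln (real p) - of_int k * c \<in> {0..c}" by (auto simp: algebra_simps)
    then obtain a where "a \<in> A" "ln (real p) - of_int k * c \<in> ball a (e a)" using A by blast
    then have "\<bar>ln (real p) - a - of_int k * c\<bar> < e a" by (simp add: dist_real_def)
    then show "p \<in> (\<Union>a\<in>A. Q \<inter> log_near c a (e a))" using \<open>a \<in> A\<close> p by (auto simp: log_near_def)
  qed
  moreover have "thin (\<Union>a\<in>A. Q \<inter> log_near c a (e a))" by (rule thin_Union[OF A(1) e(2)])
  ultimately show False using nt thin_subset by blast
qed

context coloured_family
begin

text \<open>The primes of colour q near a modulo c act by shifts near a plus multiples of c, and the
  multiples are absorbed by the period. With weights 1/(pZ) the variance is 1/Z. Only finitely many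
  multiples occur, so one threshold for x suffices.\<close>

lemma eventually_avg_accumulation:
  assumes f: "f \<in> \<F>" and q: "prime q" and c: "period c"
    and a: "\<And>e. 0 < e \<Longrightarrow> \<not> thin (class_of q \<inter> log_near c a e)" and e: "0 < e"
  shows "eventually (\<lambda>x. norm (avg f x - avg (\<lambda>n. f (q * n)) (x * exp (- a))) \<le> e) at_top"
proof -
  \<comment> \<open>Four parts are spent on the weighted comparison and one on the multiples of
    c.\<close>
  define d where "d = e / 5"
  have d: "0 < d" using e by (simp add: d_def)
  define h where "h n = f (q * n)" for n
  have h: "h \<in> \<F>" unfolding h_def by (rule dilate_closed[OF f q])
  obtain B where B: "finite B" "B \<subseteq> class_of q \<inter> log_near c a d" "1 / d\<^sup>2 < (\<Sum>p\<in>B. 1 / real p)"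
    using not_thin_obtain[OF a[OF d]] by blast
  define Z where "Z = (\<Sum>p\<in>B. 1 / real p)"
  have "0 \<le> 1 / d\<^sup>2" by simp
  then have Z: "0 < Z" "1 < d\<^sup>2 * Z" using B(3) d unfolding Z_def[symmetric]
    by (linarith, simp add: divide_less_eq mult.commute)
  have "\<forall>p\<in>B. \<exists>k::int. \<bar>ln (real p) - a - of_int k * c\<bar> < d" using B(2) by (auto simp: log_near_def)
  then obtain k :: "nat \<Rightarrow> int" where k: "\<And>p. p \<in> B \<Longrightarrow> \<bar>ln (real p) - a - of_int (k p) * c\<bar> < d" by metis
  define w where "w p = 1 / real p / Z" for p
  have w0: "0 \<le> w p" for p using Z by (simp add: w_def)
  have w1: "sum w B = 1" using Z unfolding w_def sum_divide_distrib[symmetric] Z_def by simp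
  have p0: "0 < p" if "p \<in> B" for p using that B(2) by (auto simp: class_of_def prime_gt_0_nat)
  have "eventually (\<lambda>x. norm (avg f x - (\<Sum>p\<in>B. of_real (w p) * avg h (x * exp (- (a + of_int (k p) * c))))) \<le> 4 * d) at_top"
    unfolding h_def
  proof (rule eventually_avg_weights[OF f q B(1) _ _ w1 _ d])
    have "(\<Sum>p\<in>B. real p * (w p)\<^sup>2) = (\<Sum>p\<in>B. (1 / Z) * w p)"
      using p0 by (intro sum.cong refl) (simp add: w_def power2_eq_square)
    also have "\<dots> = 1 / Z" by (simp only: sum_distrib_left[symmetric] w1)
    also have "\<dots> < d\<^sup>2" using Z by (simp add: divide_less_eq)
    finally show "(\<Sum>p\<in>B. real p * (w p)\<^sup>2) < d\<^sup>2" .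
    show "\<bar>ln (real p) - (a + of_int (k p) * c)\<bar> \<le> d" if "p \<in> B" for p
      using k[OF that] by (simp add: algebra_simps)
  qed (use B Z in \<open>auto simp: w_def\<close>)
  moreover have "eventually (\<lambda>x. \<forall>p\<in>B. norm (avg h (x * exp (- (a + of_int (k p) * c))) - avg h (x * exp (- a))) \<le> d) at_top"
  proof (intro eventually_ball_finite ballI B(1))
    fix p
    have "period (of_int (- k p) * c)" using c by (rule period_of_int_mult)
    then have "eventually (\<lambda>x. norm (avg h (x * exp (of_int (- k p) * c)) - avg h x) \<le> d) at_top"
      using d h by (simp only: period_def almost_period_def)
    from eventually_times_exp[OF this, of "- a"]
    show "eventually (\<lambda>x. norm (avg h (x * exp (- (a + of_int (k p) * c))) - avg h (x * exp (- a))) \<le> d) at_top"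
      by (simp add: mult.assoc exp_add[symmetric])
  qed
  ultimately show ?thesis
  proof eventually_elim
    case (elim x)
    have "norm ((\<Sum>p\<in>B. of_real (w p) * avg h (x * exp (- (a + of_int (k p) * c)))) - avg h (x * exp (- a)))
      = norm (\<Sum>p\<in>B. of_real (w p) * (avg h (x * exp (- (a + of_int (k p) * c))) - avg h (x * exp (- a))))"
      by (simp add: right_diff_distrib sum_subtractf sum_distrib_right[symmetric] w1 flip: of_real_sum)
    also have "\<dots> \<le> (\<Sum>p\<in>B. w p * d)"
      using elim(2) by (intro sum_norm_le) (auto simp: norm_mult w0 intro!: mult_left_mono)
    also have "\<dots> = d" by (simp add: sum_distrib_right[symmetric] w1)
    finally have "norm (avg f x - avg h (x * exp (- a))) \<le> 4 * d + d" by (rule norm_diff_triangle_le[OF elim(1)])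
    then show ?case by (simp add: d_def h_def[abs_def])
  qed
qed

text \<open>Both points express the average of f through the same dilate, with shifts differing by b
  - a.\<close>

lemma period_accumulation_diff:
  assumes q: "prime q" and c: "period c"
    and a: "\<And>e. 0 < e \<Longrightarrow> \<not> thin (class_of q \<inter> log_near c a e)"
    and b: "\<And>e. 0 < e \<Longrightarrow> \<not> thin (class_of q \<inter> log_near c b e)"
  shows "period (b - a)"
  unfolding period_def almost_period_def
proof (intro allI impI ballI)
  fix e :: real and f assume e: "0 < e" and f: "f \<in> \<F>"
  have "eventually (\<lambda>x. norm (avg f (x * exp (b - a)) - avg (\<lambda>n. f (q * n)) (x * exp (b - a) * exp (- b))) \<le> e / 2) at_top"
    using e by (intro eventually_times_exp eventually_avg_accumulation[OF f q c b]) auto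
  moreover have "eventually (\<lambda>x. norm (avg f x - avg (\<lambda>n. f (q * n)) (x * exp (- a))) \<le> e / 2) at_top"
    using e by (intro eventually_avg_accumulation[OF f q c a]) auto
  ultimately show "eventually (\<lambda>x. norm (avg f (x * exp (b - a)) - avg f x) \<le> e) at_top"
  proof eventually_elim
    case (elim x)
    then have "norm (avg f (x * exp (b - a)) - avg (\<lambda>n. f (q * n)) (x * exp (- a))) \<le> e / 2"
      "norm (avg (\<lambda>n. f (q * n)) (x * exp (- a)) - avg f x) \<le> e / 2"
      by (simp_all add: mult.assoc exp_add[symmetric] norm_minus_commute)
    from norm_diff_triangle_le[OF this] show ?case by simp
  qed
qed

text \<open>A remainder off the arc that is not thin would accumulate at some b. Then b - a is a
  period, hence a multiple of c, and the arc around b is the one that was removed.\<close>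

lemma thin_class_diff_log_near:
  assumes q: "prime q" and c: "0 < c" "period c" "\<And>s. period s \<Longrightarrow> \<exists>k. s = of_int k * c"
  obtains a where "\<And>e. 0 < e \<Longrightarrow> thin (class_of q - log_near c a e)"
proof (cases "thin (class_of q)")
  case True
  then show ?thesis using that thin_subset[OF True] by blast
next
  case False
  obtain a where a: "\<And>e. 0 < e \<Longrightarrow> \<not> thin (class_of q \<inter> log_near c a e)"
    using not_thin_accumulation[OF False c(1)] by blast
  have "thin (class_of q - log_near c a e)" if e: "0 < e" for e
  proof (rule ccontr)
    assume nt: "\<not> thin (class_of q - log_near c a e)"
    obtain b where b: "\<And>e'. 0 < e' \<Longrightarrow> \<not> thin ((class_of q - log_near c a e) \<inter> log_near c b e')"
      using not_thin_accumulation[OF nt c(1)] by blast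
    have b': "\<not> thin (class_of q \<inter> log_near c b e')" if "0 < e'" for e'
      using b[OF that] thin_subset[of "class_of q \<inter> log_near c b e'" "(class_of q - log_near c a e) \<inter> log_near c b e'"]
      by auto
    have "period (b - a)" by (rule period_accumulation_diff[OF q c(2)]) (simp_all add: a b')
    then obtain k where "b - a = of_int k * c" using c(3) by blast
    then have "b = a + of_int k * c" by simp
    then have "(class_of q - log_near c a e) \<inter> log_near c b e = {}" by (auto simp: log_near_shift)
    then show False using b[OF e] by (simp add: thin_def)
  qed
  then show ?thesis by (rule that)
qed

text \<open>A discrete group of periods \<open>c\<int>\<close> would force each colour class to concentrate at one point modulo
  \<open>c\<close>; by Dirichlet's theorem these points are simultaneously close to \<open>0\<close> modulo \<open>c / k\<close> for some \<open>k\<close>.\<close>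

lemma all_periods: "period s"
proof (rule ccontr)
  assume "\<not> period s"
  then obtain c where c: "0 < c" "period c" "\<And>s. period s \<Longrightarrow> \<exists>k. s = of_int k * c"
    by (metis periods_dichotomy)
  define n where "n = card (col ` {p. prime p})"
  obtain i where i: "bij_betw i {0..<n} (col ` {p. prime p})"
    using ex_bij_betw_nat_finite[OF fincol] unfolding n_def by blast
  have "\<exists>q. prime q \<and> col q = i j" if "j < n" for j
  proof -
    have "i j \<in> col ` {p. prime p}" using i that by (intro bij_betw_apply[OF i]) simp
    then show ?thesis by auto
  qed
  then obtain r where r: "\<And>j. j < n \<Longrightarrow> prime (r j)" "\<And>j. j < n \<Longrightarrow> col (r j) = i j" by metis
  have "\<exists>a. \<forall>e>0. thin (class_of (r j) - log_near c a e)" if "j < n" for j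
    by (rule thin_class_diff_log_near[OF r(1)[OF that] c]) blast+
  then obtain a where a: "\<And>j e. j < n \<Longrightarrow> 0 < e \<Longrightarrow> thin (class_of (r j) - log_near c (a j) e)" by metis
  \<comment> \<open>Two errors of pi/6 are allowed: 2 pi/12 from the simultaneous approximation and
    t e from the arc. Together they stay within pi/3 of a multiple of 2 pi, where cos \<ge>
    1/2.\<close>
  have "0 < (12::nat)" by simp
  from Dirichlet_approx_simult[OF this, of n "\<lambda>j. a j / c"]
  obtain k m where k: "0 < k" "\<And>j. j < n \<Longrightarrow> \<bar>of_int k * (a j / c) - of_int (m j)\<bar> < 1 / real 12"
    by metis
  define t where "t = 2 * pi * of_int k / c"
  have t: "0 < t" using k c by (simp add: t_def)
  define e where "e = pi / (6 * t)"
  have e: "0 < e" using t by (simp add: e_def)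
  have "{p. prime p \<and> cos (t * ln (real p)) < 1 / 2} \<subseteq> (\<Union>j\<in>{0..<n}. class_of (r j) - log_near c (a j) e)"
  proof clarify
    fix p :: nat assume p: "prime p" "cos (t * ln (real p)) < 1 / 2"
    have "col p \<in> i ` {0..<n}" using bij_betw_imp_surj_on[OF i] p by simp
    then obtain j where j: "j < n" "i j = col p" by auto
    have "p \<notin> log_near c (a j) e"
    proof
      assume "p \<in> log_near c (a j) e"
      then obtain l :: int where l: "\<bar>ln (real p) - a j - of_int l * c\<bar> < e" by (auto simp: log_near_def)
      have "t * ln (real p) - 2 * pi * of_int (m j + k * l)
        = t * (ln (real p) - a j - of_int l * c) + 2 * pi * (of_int k * (a j / c) - of_int (m j))"
        using c by (simp add: t_def field_simps)
      also have "\<bar>\<dots>\<bar> \<le> t * \<bar>ln (real p) - a j - of_int l * c\<bar> + 2 * pi * \<bar>of_int k * (a j / c) - of_int (m j)\<bar>"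
        using t by (intro order.trans[OF abs_triangle_ineq]) (simp add: abs_mult)
      also have "\<dots> \<le> t * e + 2 * pi * (1 / real 12)"
        using l k(2)[OF j(1)] t by (intro add_mono mult_left_mono) auto
      also have "\<dots> = pi / 3" using t by (simp add: e_def)
      finally have "1 / 2 \<le> cos (t * ln (real p))" by (rule cos_ge_half)
      then show False using p by simp
    qed
    then show "p \<in> (\<Union>j\<in>{0..<n}. class_of (r j) - log_near c (a j) e)"
      using j p r[OF j(1)] by (intro UN_I[of j]) (auto simp: class_of_def)
  qed
  moreover have "thin (\<Union>j\<in>{0..<n}. class_of (r j) - log_near c (a j) e)"
    using a e by (intro thin_Union) auto
  ultimately show False using not_thin_cos_less_half[of t] t thin_subset by blast
qed

text \<open>Every real being a period, any modulus gives an accumulation point a, here modulo 1, and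
  the remaining shift by -a is itself a period.\<close>

lemma avg_dilate_tendsto:
  assumes f: "f \<in> \<F>" and q: "prime q" "\<not> thin (class_of q)"
  shows "((\<lambda>x. avg (\<lambda>n. f (q * n)) x - avg f x) \<longlongrightarrow> 0) at_top"
proof (rule tendstoI)
  fix e :: real assume e: "0 < e"
  define h where "h n = f (q * n)" for n
  have h: "h \<in> \<F>" unfolding h_def by (rule dilate_closed[OF f q(1)])
  obtain a where a: "\<And>e. 0 < e \<Longrightarrow> \<not> thin (class_of q \<inter> log_near 1 a e)"
    using not_thin_accumulation[OF q(2), of 1] by auto
  have "eventually (\<lambda>x. norm (avg f x - avg h (x * exp (- a))) \<le> e / 3) at_top"
    unfolding h_def using e by (intro eventually_avg_accumulation[OF f q(1) all_periods a]) auto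
  moreover have "eventually (\<lambda>x. norm (avg h (x * exp (- a)) - avg h x) \<le> e / 3) at_top"
    using all_periods[of "- a"] e h unfolding period_def almost_period_def
    by (elim allE[of _ "e / 3"] impE ballE) auto
  ultimately show "eventually (\<lambda>x. dist (avg (\<lambda>n. f (q * n)) x - avg f x) 0 < e) at_top"
  proof eventually_elim
    case (elim x)
    have "norm (avg f x - avg h x) \<le> e / 3 + e / 3" by (rule norm_diff_triangle_le[OF elim])
    then show ?case using e by (simp add: h_def[symmetric] norm_minus_commute)
  qed
qed

end

section \<open>Weak limits of empirical measures\<close>

text \<open>With digits 0 and 2, the first differing digit k contributes 2/3^(k+1) and all later
  ones together at most 1/3^(k+1); so the values differ by at least 1/3^(k+1).\<close>

lemma ternary_digits_eq:
  fixes b b' :: "nat \<Rightarrow> bool"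
  assumes "\<bar>(\<Sum>j. 2 * of_bool (b j) * (1/3) ^ Suc j) - (\<Sum>j. 2 * of_bool (b' j) * (1/3) ^ Suc j)\<bar> < ((1/3) ^ Suc n :: real)"
    and "m \<le> n"
  shows "b m = b' m"
proof (rule ccontr)
  assume "b m \<noteq> b' m"
  define k where "k = (LEAST m. b m \<noteq> b' m)"
  have k: "b k \<noteq> b' k" "k \<le> m" "\<And>j. j < k \<Longrightarrow> b j = b' j"
    unfolding k_def by (rule LeastI, fact) (rule Least_le, fact, blast dest: not_less_Least)
  define g where "g j = 2 * (of_bool (b j) - of_bool (b' j)) * (1/3 :: real) ^ Suc j" for j
  have geo: "summable (\<lambda>j. 2 * (1/3 :: real) ^ Suc j)" by (intro summable_mult summable_Suc_iff[THEN iffD2] summable_geometric) simp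
  have sm: "summable (\<lambda>j. 2 * of_bool (c j) * (1/3 :: real) ^ Suc j)" for c :: "nat \<Rightarrow> bool"
    by (rule summable_comparison_test'[OF geo]) (auto simp: abs_mult)
  have abs_g: "\<bar>g j\<bar> \<le> 2 * (1/3) ^ Suc j" for j by (auto simp: g_def)
  have smg: "summable g" by (rule summable_comparison_test'[OF geo]) (use abs_g in auto)
  have "(\<Sum>j. 2 * of_bool (b j) * (1/3) ^ Suc j) - (\<Sum>j. 2 * of_bool (b' j) * (1/3) ^ Suc j) = (\<Sum>j. g j)"
    unfolding g_def by (subst suminf_diff[OF sm sm]) (simp add: algebra_simps)
  also have "\<dots> = (\<Sum>j. g (j + Suc k)) + (\<Sum>j<Suc k. g j)"
    by (rule suminf_split_initial_segment[OF smg])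
  also have "(\<Sum>j<Suc k. g j) = g k" using k(3) by (simp add: g_def)
  finally have eq: "(\<Sum>j. 2 * of_bool (b j) * (1/3) ^ Suc j) - (\<Sum>j. 2 * of_bool (b' j) * (1/3) ^ Suc j) = (\<Sum>j. g (j + Suc k)) + g k" .
  have geo': "(\<lambda>j. 2 * (1/3 :: real) ^ Suc (j + Suc k)) sums ((1/3) ^ Suc k)"
    using sums_mult[OF geometric_sums[of "1/3 :: real"], of "2 * (1/3) ^ Suc (Suc k)"] by (simp add: power_add mult_ac)
  have "\<bar>\<Sum>j. g (j + Suc k)\<bar> \<le> (\<Sum>j. 2 * (1/3 :: real) ^ Suc (j + Suc k))"
    unfolding real_norm_def[symmetric]
    by (rule norm_suminf_le[OF _ sums_summable[OF geo']]) (simp only: real_norm_def abs_g)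
  also have "\<dots> = (1/3) ^ Suc k" using geo' by (rule sums_unique[symmetric])
  finally have "\<bar>\<Sum>j. g (j + Suc k)\<bar> \<le> (1/3) ^ Suc k" .
  moreover have "\<bar>g k\<bar> = 2 * (1/3) ^ Suc k" using k(1) by (cases "b k") (auto simp: g_def)
  ultimately have "(1/3) ^ Suc k \<le> \<bar>(\<Sum>j. g (j + Suc k)) + g k\<bar>" by linarith
  moreover have "(1/3 :: real) ^ Suc n \<le> (1/3) ^ Suc k" using k(2) assms(2) by (intro power_decreasing) auto
  ultimately show False using assms(1) unfolding eq by linarith
qed

text \<open>A coding of a compact metric space by points of the Cantor set whose inverse is uniformly continuous.
  The coding itself need not even be measurable: only finite sums of point masses are transported by it.\<close>

lemma compact_coding:
  assumes "compact (UNIV :: 'a::metric_space set)"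
  obtains c :: "'a::metric_space \<Rightarrow> real" where "\<And>x. c x \<in> {0..1}"
    "\<And>e. 0 < e \<Longrightarrow> \<exists>d>0. \<forall>x y. \<bar>c x - c y\<bar> < d \<longrightarrow> dist x y < e"
proof -
  have "\<forall>k. \<exists>T. finite T \<and> (UNIV :: 'a set) \<subseteq> (\<Union>t\<in>T. ball t (1 / real (Suc k)))"
    using compact_eq_totally_bounded[of "UNIV :: 'a set"] assms by (metis of_nat_0_less_iff zero_less_Suc zero_less_divide_1_iff)
  then obtain T :: "nat \<Rightarrow> 'a set" where T: "\<And>k. finite (T k)" "\<And>k. UNIV \<subseteq> (\<Union>t\<in>T k. ball t (1 / real (Suc k)))" by metis
  define P where "P = (SIGMA k:UNIV. T k)"
  have "countable P" unfolding P_def using T(1) by (intro countable_SIGMA) (auto intro: countable_finite)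
  have "T 0 \<noteq> {}" using T(2)[of 0] by auto
  then have "P \<noteq> {}" by (auto simp: P_def)
  define E where "E = from_nat_into P"
  have E: "range E = P" unfolding E_def using \<open>P \<noteq> {}\<close> \<open>countable P\<close> by (rule range_from_nat_into)
  \<comment> \<open>The j-th digit records whether x lies in the j-th ball of an enumeration of
    finite nets of all scales.\<close>
  define b where "b x j \<longleftrightarrow> dist (snd (E j)) x < 1 / real (Suc (fst (E j)))" for x j
  define c where "c x = (\<Sum>j. 2 * of_bool (b x j) * (1/3) ^ Suc j :: real)" for x
  have s1: "(\<lambda>j. 2 * (1/3 :: real) ^ Suc j) sums 1"
    using sums_mult[OF geometric_sums[of "1/3 :: real"], of "2 / 3"] by simp
  have sm: "summable (\<lambda>j. 2 * of_bool (b x j) * (1/3 :: real) ^ Suc j)" for x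
    by (rule summable_comparison_test'[OF sums_summable[OF s1]]) (auto simp: abs_mult)
  show ?thesis
  proof
    fix x
    have "0 \<le> c x" unfolding c_def by (rule suminf_nonneg[OF sm]) simp
    moreover have "c x \<le> (\<Sum>j. 2 * (1/3 :: real) ^ Suc j)"
      unfolding c_def by (rule suminf_le[OF _ sm sums_summable[OF s1]]) auto
    ultimately show "c x \<in> {0..1}" using sums_unique[OF s1] by simp
  next
    fix e :: real assume "0 < e"
    then obtain k where k: "2 / e < real k" using reals_Archimedean2 by blast
    have k0: "0 < real k" using k \<open>0 < e\<close> less_trans[of 0 "2/e" "real k"] by simp
    have "\<forall>t\<in>T k. \<exists>j. E j = (k, t)" using E by (force simp: P_def)
    then obtain J where J: "\<And>t. t \<in> T k \<Longrightarrow> E (J t) = (k, t)" by metis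
    \<comment> \<open>Codes closer than 1/3^(n+1) share their digits up to n, hence lie in the same
      balls of scale k; two points in one such ball are less than e apart because 2/k < e.\<close>
    define n where "n = Max (insert 0 (J ` T k))"
    have n: "J t \<le> n" if "t \<in> T k" for t unfolding n_def using T(1) that by (intro Max_ge) auto
    have "dist x y < e" if xy: "\<bar>c x - c y\<bar> < (1/3) ^ Suc n" for x y
    proof -
      obtain t where t: "t \<in> T k" "dist t x < 1 / real (Suc k)" using T(2)[of k] by (auto simp: subset_eq)
      then have "b x (J t)" by (simp add: b_def J)
      moreover have "b x (J t) = b y (J t)"
        by (rule ternary_digits_eq[OF xy[unfolded c_def] n[OF t(1)]])
      ultimately have "dist t y < 1 / real (Suc k)" using t by (simp add: b_def J)
      then have "dist x y < 1 / real (Suc k) + 1 / real (Suc k)"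
        using dist_triangle_less_add[of x t "1 / real (Suc k)" y "1 / real (Suc k)"] t(2) by (simp only: dist_commute)
      also have "\<dots> = 2 / real (Suc k)" by simp
      also have "\<dots> \<le> 2 / real k" using k0 by (intro divide_left_mono) auto
      also have "\<dots> < e" using k k0 \<open>0 < e\<close> by (simp add: field_simps)
      finally show ?thesis .
    qed
    then show "\<exists>d>0. \<forall>x y. \<bar>c x - c y\<bar> < d \<longrightarrow> dist x y < e" by (intro exI[of _ "(1/3) ^ Suc n"]) auto
  qed
qed

text \<open>The range of the coding need not be closed, but its uniformly continuous inverse extends
  to the closure K: a point of K is sent to the limit of points whose codes approach it. So the
  space is a continuous image of a compact set of reals.\<close>

lemma compact_coding_inverse:
  assumes "compact (UNIV :: 'a::metric_space set)"
  obtains c :: "'a::metric_space \<Rightarrow> real" and K and \<pi> where "compact K" "K \<subseteq> {0..1}" "range c \<subseteq> K" "continuous_on K \<pi>" "\<And>x. \<pi> (c x) = x"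
proof -
  obtain c :: "'a \<Rightarrow> real" where c: "\<And>x. c x \<in> {0..1}"
    "\<And>e. 0 < e \<Longrightarrow> \<exists>d>0. \<forall>x y. \<bar>c x - c y\<bar> < d \<longrightarrow> dist x y < e"
    using compact_coding[OF assms] by metis
  define K where "K = closure (range c)"
  have K01: "K \<subseteq> {0..1}" unfolding K_def by (rule closure_minimal) (use c(1) in auto)
  have "\<exists>y. \<forall>e>0. \<exists>d>0. \<forall>z. \<bar>c z - x\<bar> < d \<longrightarrow> dist z y \<le> e" if "x \<in> K" for x
  proof -
    have "\<exists>u. (\<forall>n. u n \<in> range c) \<and> u \<longlonglongrightarrow> x" using that unfolding K_def closure_sequential .
    then obtain u where u: "\<forall>n. \<exists>w. u n = c w" "u \<longlonglongrightarrow> x" by (auto simp: image_iff)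
    from choice[OF u(1)] obtain z where z: "\<And>n. u n = c (z n)" by auto
    obtain y r where yr: "strict_mono r" "(z \<circ> r) \<longlonglongrightarrow> y"
      using assms[unfolded compact_def, rule_format, of z] by auto
    have cz: "(\<lambda>n. c (z (r n))) \<longlonglongrightarrow> x"
      using LIMSEQ_subseq_LIMSEQ[OF u(2) yr(1)] by (simp add: z o_def)
    show ?thesis
    proof (intro exI[of _ y] allI impI)
      fix e :: real assume "0 < e"
      then obtain d where d: "0 < d" "\<And>x y. \<bar>c x - c y\<bar> < d \<Longrightarrow> dist x y < e" using c(2)[of e] by auto
      have "dist w y \<le> e" if w: "\<bar>c w - x\<bar> < d" for w
      proof (rule tendsto_upperbound)
        show "(\<lambda>n. dist w ((z \<circ> r) n)) \<longlonglongrightarrow> dist w y" by (intro tendsto_dist tendsto_const yr(2))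
        have "(\<lambda>n. \<bar>c w - c (z (r n))\<bar>) \<longlonglongrightarrow> \<bar>c w - x\<bar>" by (intro tendsto_intros cz)
        then have "eventually (\<lambda>n. \<bar>c w - c (z (r n))\<bar> < d) sequentially" using w by (rule order_tendstoD)
        then show "eventually (\<lambda>n. dist w ((z \<circ> r) n) \<le> e) sequentially"
          by eventually_elim (auto intro: less_imp_le d(2))
      qed simp
      then show "\<exists>d>0. \<forall>z. \<bar>c z - x\<bar> < d \<longrightarrow> dist z y \<le> e" using d(1) by blast
    qed
  qed
  then have "\<forall>x\<in>K. \<exists>y. \<forall>e>0. \<exists>d>0. \<forall>z. \<bar>c z - x\<bar> < d \<longrightarrow> dist z y \<le> e" by (rule ballI)
  from bchoice[OF this] obtain \<pi> where
    \<pi>: "\<forall>x\<in>K. \<forall>e>0. \<exists>d>0. \<forall>z. \<bar>c z - x\<bar> < d \<longrightarrow> dist z (\<pi> x) \<le> e" by (elim exE)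
  have sub: "range c \<subseteq> K" unfolding K_def by (rule closure_subset)
  show ?thesis
  proof
    show "compact K" unfolding K_def compact_closure by (rule bounded_subset[of "{0..1}"]) (use c(1) in auto)
    show "K \<subseteq> {0..1}" by (rule K01)
    show "range c \<subseteq> K" by (rule sub)
    show "\<pi> (c x) = x" for x
    proof -
      have "c x \<in> K" using sub by auto
      have "dist x (\<pi> (c x)) \<le> 0"
      proof (rule field_le_epsilon)
        fix e :: real assume "0 < e"
        with \<open>c x \<in> K\<close> show "dist x (\<pi> (c x)) \<le> 0 + e" using \<pi>[rule_format, of "c x" e] by auto
      qed
      then show ?thesis by simp
    qed
    show "continuous_on K \<pi>"
      unfolding continuous_on_iff
    proof (intro ballI allI impI)
      fix x and e :: real assume x: "x \<in> K" and e: "0 < e"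
      obtain d where d: "0 < d" "\<And>z. \<bar>c z - x\<bar> < d \<Longrightarrow> dist z (\<pi> x) \<le> e / 3"
        using \<pi>[rule_format, OF x, of "e / 3"] e by auto
      have "dist (\<pi> x') (\<pi> x) < e" if x': "x' \<in> K" "dist x' x < d / 2" for x'
      proof -
        obtain d' where d': "0 < d'" "\<And>z. \<bar>c z - x'\<bar> < d' \<Longrightarrow> dist z (\<pi> x') \<le> e / 3"
          using \<pi>[rule_format, OF x'(1), of "e / 3"] e by auto
        have "0 < min d' (d / 2)" using d d' by simp
        then have "\<exists>y\<in>range c. dist y x' < min d' (d / 2)"
          using x'(1) unfolding K_def closure_approachable by (elim allE impE)
        then obtain z where z: "\<bar>c z - x'\<bar> < min d' (d / 2)"
          unfolding dist_real_def by (elim bexE rangeE) auto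
        have "\<bar>c z - x\<bar> < d" using z x'(2) unfolding dist_real_def min_less_iff_conj by linarith
        then have "dist z (\<pi> x) \<le> e / 3" by (rule d)
        moreover have "dist z (\<pi> x') \<le> e / 3" using z by (intro d') auto
        ultimately show ?thesis using dist_triangle3[of "\<pi> x'" "\<pi> x" z] e by simp
      qed
      then show "\<exists>d>0. \<forall>x'\<in>K. dist x' x < d \<longrightarrow> dist (\<pi> x') (\<pi> x) < e" using d(1) by (intro exI[of _ "d / 2"]) auto
    qed
  qed
qed

section \<open>Borel probability measures and continuous test functions\<close>

lemma borel_prob_integrable:
  fixes h :: "'a::metric_space \<Rightarrow> 'b::{banach, second_countable_topology}"
  assumes "compact (UNIV :: 'a set)" "borel_prob \<mu>" "continuous_on UNIV h"
  shows "integrable \<mu> h"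
proof -
  interpret prob_space \<mu> using assms(2) by (simp add: borel_prob_def)
  have "bounded (range h)" using compact_continuous_image[OF assms(3,1)] by (rule compact_imp_bounded)
  then obtain B where "\<And>x. norm (h x) \<le> B" by (auto simp: bounded_iff)
  moreover have "sets \<mu> = sets borel" using assms(2) by (simp add: borel_prob_def)
  then have "h \<in> borel_measurable \<mu>"
    using borel_measurable_continuous_onI[OF assms(3)] by (simp cong: measurable_cong_sets)
  ultimately show ?thesis by (intro integrable_const_bound[of _ B]) auto
qed

text \<open>The closed sets form an intersection-stable generator, and the indicator of a nonempty
  closed set is a limit of truncated distance functions. The empty set is treated apart, as
  \<open>infdist\<close> to it is 0 by convention.\<close>

lemma borel_prob_eqI:
  fixes \<mu> \<mu>' :: "'a::metric_space measure"
  assumes cpt: "compact (UNIV :: 'a set)" and \<mu>: "borel_prob \<mu>" and \<mu>': "borel_prob \<mu>'"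
    and eq: "\<And>h :: 'a \<Rightarrow> real. continuous_on UNIV h \<Longrightarrow> (\<integral>x. h x \<partial>\<mu>) = (\<integral>x. h x \<partial>\<mu>')"
  shows "\<mu> = \<mu>'"
proof (rule measure_eqI_generator_eq[where E = "Collect closed" and \<Omega> = UNIV and A = "\<lambda>_. UNIV"])
  have lim: "(\<lambda>n. \<integral>x. max 0 (1 - real n * infdist x C) \<partial>M) \<longlonglongrightarrow> measure M C"
    if C: "closed C" "C \<noteq> {}" and M: "borel_prob M" for C and M :: "'a measure"
  proof -
    interpret prob_space M using M by (simp add: borel_prob_def)
    have sM: "sets M = sets borel" using M by (simp add: borel_prob_def)
    then have CM: "C \<in> sets M" using C by simp
    have "(\<lambda>n. \<integral>x. max 0 (1 - real n * infdist x C) \<partial>M) \<longlonglongrightarrow> (\<integral>x. indicat_real C x \<partial>M)"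
    proof (rule integral_dominated_convergence[where w = "\<lambda>_. 1"])
      show "indicat_real C \<in> borel_measurable M" using CM by simp
      show "(\<lambda>x. max 0 (1 - real n * infdist x C)) \<in> borel_measurable M" for n
        by (rule borel_measurable_integrable[OF borel_prob_integrable[OF cpt M]]) (intro continuous_intros)
      show "AE x in M. (\<lambda>n. max 0 (1 - real n * infdist x C)) \<longlonglongrightarrow> indicat_real C x"
      proof (rule AE_I2)
        fix x
        show "(\<lambda>n. max 0 (1 - real n * infdist x C)) \<longlonglongrightarrow> indicat_real C x"
        proof (cases "x \<in> C")
          case False
          then have "0 < infdist x C" using C infdist_pos_not_in_closed by blast
          then obtain N where N: "1 / infdist x C < real N" using reals_Archimedean2 by blast
          have "eventually (\<lambda>n. max 0 (1 - real n * infdist x C) = 0) sequentially"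
            using eventually_ge_at_top[of N]
          proof eventually_elim
            case (elim n)
            then have "1 / infdist x C \<le> real n" using N by linarith
            then have "1 \<le> real n * infdist x C" using \<open>0 < infdist x C\<close> by (simp add: pos_divide_le_eq)
            then show ?case by simp
          qed
          then show ?thesis using False by (auto intro: tendsto_eventually)
        qed simp
      qed
      show "AE x in M. norm (max 0 (1 - real n * infdist x C)) \<le> 1" for n by (auto simp: infdist_nonneg)
    qed simp
    then show ?thesis by (simp add: Bochner_Integration.integral_indicator CM)
  qed
  interpret \<mu>: prob_space \<mu> using \<mu> by (simp add: borel_prob_def)
  interpret \<mu>': prob_space \<mu>' using \<mu>' by (simp add: borel_prob_def)
  show "emeasure \<mu> C = emeasure \<mu>' C" if "C \<in> Collect closed" for C
  proof (cases "C = {}")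
    case False
    have "(\<lambda>n. \<integral>x. max 0 (1 - real n * infdist x C) \<partial>\<mu>) \<longlonglongrightarrow> measure \<mu> C"
      using that False by (intro lim \<mu>) auto
    moreover have "(\<lambda>n. \<integral>x. max 0 (1 - real n * infdist x C) \<partial>\<mu>) \<longlonglongrightarrow> measure \<mu>' C"
    proof -
      have "(\<integral>x. max 0 (1 - real n * infdist x C) \<partial>\<mu>) = (\<integral>x. max 0 (1 - real n * infdist x C) \<partial>\<mu>')" for n
        by (intro eq continuous_intros)
      then show ?thesis using lim[OF _ False \<mu>'] that by simp
    qed
    ultimately have "measure \<mu> C = measure \<mu>' C" by (rule LIMSEQ_unique)
    then show ?thesis by (simp add: \<mu>.emeasure_eq_measure \<mu>'.emeasure_eq_measure)
  qed simp
  show "emeasure \<mu> UNIV \<noteq> \<infinity>" by simp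
  have "sets (borel :: 'a measure) = sigma_sets UNIV (Collect closed)" by (subst borel_eq_closed) simp
  then show "sets \<mu> = sigma_sets UNIV (Collect closed)" "sets \<mu>' = sigma_sets UNIV (Collect closed)"
    using \<mu> \<mu>' by (simp_all add: borel_prob_def)
qed (auto simp: Int_stable_def)

text \<open>Weak compactness is available on the real line by Helly's theorem, so the point masses
  are carried into [0, 1] by the coding and the limit is carried back by its continuous inverse.
  \<open>Suc\<close> keeps the index sets nonempty.\<close>

lemma empirical_measures_convergent_subseq:
  fixes z :: "nat \<Rightarrow> 'a::metric_space"
  assumes cpt: "compact (UNIV :: 'a set)" and s: "strict_mono (s :: nat \<Rightarrow> nat)"
  obtains r \<mu> where "strict_mono (r :: nat \<Rightarrow> nat)" "borel_prob \<mu>"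
    "\<And>h :: 'a \<Rightarrow> real. continuous_on UNIV h \<Longrightarrow>
       (\<lambda>k. (\<Sum>n=1..Suc (s (r k)). h (z n)) / real (Suc (s (r k)))) \<longlonglongrightarrow> (\<integral>x. h x \<partial>\<mu>)"
proof -
  obtain c :: "'a \<Rightarrow> real" and K \<pi> where c: "compact K" "K \<subseteq> {0..1}" "range c \<subseteq> K" "continuous_on K \<pi>" "\<And>x. \<pi> (c x) = x"
    using compact_coding_inverse[OF cpt] by metis
  define E where "E N = distr (measure_pmf (pmf_of_set {1..Suc N})) borel (\<lambda>n. c (z n))" for N
  have E_real: "real_distribution (E N)" for N
    unfolding E_def by (intro prob_space.real_distribution_distr measure_pmf.prob_space_axioms) simp
  have E_int: "integral\<^sup>L (E N) H = (\<Sum>n=1..Suc N. H (c (z n))) / real (Suc N)" if "continuous_on UNIV H" for H :: "real \<Rightarrow> real" and N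
    unfolding E_def using borel_measurable_continuous_onI[OF that]
    by (subst integral_distr) (simp_all add: integral_pmf_of_set)
  have "tight E"
    unfolding tight_def
  proof (intro conjI allI impI)
    fix \<epsilon> :: real assume "0 < \<epsilon>"
    have "measure (E N) {-1<..1} = 1" for N
    proof -
      have "(\<lambda>n. c (z n)) -` {-1<..1} = UNIV" using c(2,3) by fastforce
      then show ?thesis unfolding E_def by (subst measure_distr) (simp_all add: measure_pmf.prob_space[simplified])
    qed
    then show "\<exists>a b. a < b \<and> (\<forall>n. 1 - \<epsilon> < measure (E n) {a<..b})" using \<open>0 < \<epsilon>\<close>
      by (intro exI[of _ "-1"] exI[of _ 1]) auto
  qed (rule E_real)
  then obtain r M where r: "strict_mono r" and M: "real_distribution M" "weak_conv_m (E \<circ> s \<circ> r) M"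
    using tight_imp_convergent_subsubsequence[OF _ s] by blast
  interpret M: real_distribution M by (rule M)
  have conv: "(\<lambda>k. (\<Sum>n=1..Suc (s (r k)). H (c (z n))) / real (Suc (s (r k)))) \<longlonglongrightarrow> integral\<^sup>L M H"
    if H: "continuous_on UNIV H" "\<And>x. norm (H x) \<le> B" for H :: "real \<Rightarrow> real" and B
  proof -
    have "(\<lambda>k. integral\<^sup>L ((E \<circ> s \<circ> r) k) H) \<longlonglongrightarrow> integral\<^sup>L M H"
      using H(1) by (intro weak_conv_imp_integral_bdd_continuous_conv[OF _ M _ H(2)])
        (auto simp: E_real continuous_on_eq_continuous_at)
    then show ?thesis by (simp only: o_def E_int[OF H(1)])
  qed
  have K_closed: "closed K" using c(1) by (rule compact_imp_closed)
  have K_ne: "K \<noteq> {}" using c(3) by auto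
  have AE_K: "AE x in M. x \<in> K"
  proof -
    \<comment> \<open>A bounded continuous function vanishing exactly on K: it vanishes at all
      codes, so its integral in the limit is 0 and the limit measure lives on K.\<close>
    define H where "H x = min 1 (infdist x K)" for x
    have cH: "continuous_on UNIV H" unfolding H_def by (intro continuous_intros)
    have bH: "norm (H x) \<le> 1" for x by (auto simp: H_def infdist_nonneg)
    have "H (c (z n)) = 0" for n using c(3) by (simp add: H_def image_subset_iff)
    then have "(\<lambda>k. 0) \<longlonglongrightarrow> integral\<^sup>L M H" using conv[OF cH bH] by simp
    then have "integral\<^sup>L M H = 0" by (simp add: LIMSEQ_const_iff)
    moreover have mH: "H \<in> borel_measurable M"
      using borel_measurable_continuous_onI[OF cH] by simp
    moreover have "integrable M H" by (rule M.integrable_const_bound[of _ 1]) (use bH mH in auto)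
    ultimately have "AE x in M. H x = 0"
      by (subst integral_nonneg_eq_0_iff_AE[symmetric]) (auto simp: H_def infdist_nonneg)
    then show ?thesis
    proof eventually_elim
      case (elim x)
      then have "infdist x K = 0" by (auto simp: H_def min_def split: if_splits)
      then show ?case using in_closed_iff_infdist_zero[OF K_closed K_ne] by simp
    qed
  qed
  define \<pi>' where "\<pi>' x = (if x \<in> K then \<pi> x else z 0)" for x
  have m\<pi>: "\<pi>' \<in> borel_measurable borel"
    unfolding \<pi>'_def using borel_measurable_continuous_on_restrict[OF c(4)] K_closed
    by (subst measurable_If_restrict_space_iff) auto
  then have m\<pi>M: "\<pi>' \<in> measurable M borel" by simp
  define \<mu> where "\<mu> = distr M borel \<pi>'"
  have \<mu>: "borel_prob \<mu>"
    unfolding borel_prob_def \<mu>_def using M.prob_space_distr[OF m\<pi>M] by simp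
  show ?thesis
  proof (rule that[OF r \<mu>])
    fix h :: "'a \<Rightarrow> real" assume h: "continuous_on UNIV h"
    have "bounded (range h)" using compact_continuous_image[OF h cpt] by (rule compact_imp_bounded)
    then obtain B where B: "\<And>x. norm (h x) \<le> B" by (auto simp: bounded_iff)
    have B0: "0 \<le> B" using B[of undefined] norm_ge_zero order.trans by blast
    have ch: "continuous_on K (\<lambda>x. h (\<pi> x))"
      using continuous_on_compose2[OF h c(4)] by simp
    \<comment> \<open>Weak convergence tests functions on the whole line, while h o \<pi> is
      meaningful on K only; hence a bounded Tietze extension.\<close>
    obtain H where H: "continuous_on UNIV H" "\<And>x. x \<in> K \<Longrightarrow> H x = h (\<pi> x)" "\<And>x. x \<in> UNIV \<Longrightarrow> norm (H x) \<le> B"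
      using Tietze[OF ch _ B0, of UNIV] K_closed B by auto
    have Hc: "H (c (z n)) = h (z n)" for n using c(3,5) H(2)[of "c (z n)"] by auto
    have "(\<integral>x. h x \<partial>\<mu>) = (\<integral>x. h (\<pi>' x) \<partial>M)"
      unfolding \<mu>_def using borel_measurable_continuous_onI[OF h] m\<pi>M by (subst integral_distr) auto
    also have "\<dots> = integral\<^sup>L M H"
    proof (rule integral_cong_AE)
      show "AE x in M. h (\<pi>' x) = H x" using AE_K by eventually_elim (simp add: \<pi>'_def H(2))
      show "(\<lambda>x. h (\<pi>' x)) \<in> borel_measurable M"
        using measurable_compose[OF m\<pi>M borel_measurable_continuous_onI[OF h]] .
      show "H \<in> borel_measurable M" using borel_measurable_continuous_onI[OF H(1)] by simp
    qed
    finally show "(\<lambda>k. (\<Sum>n=1..Suc (s (r k)). h (z n)) / real (Suc (s (r k)))) \<longlonglongrightarrow> (\<integral>x. h x \<partial>\<mu>)"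
      using conv[OF H(1,3)] by (simp add: Hc)
  qed
qed

section \<open>Strong unique ergodicity\<close>

text \<open>The value at \<open>0\<close> is only bounded, since \<open>S 0\<close> is arbitrary and does not commute with dilation.\<close>

lemma coloured_family_orbit:
  fixes S :: "nat \<Rightarrow> 'a::metric_space \<Rightarrow> 'a"
  assumes S: "mult_tds S" "finitely_generated S"
  shows "coloured_family {f. norm (f 0) \<le> 1 \<and> (\<exists>h. continuous_on UNIV h \<and> (\<forall>x. norm (h x) \<le> 1) \<and> (\<forall>n\<ge>1. f n = h (S n y)))} S"
    (is "coloured_family ?F S")
proof
  have mult: "S (n * m) x = S n (S m x)" if "1 \<le> n" "1 \<le> m" for n m x
    using S(1) that by (simp add: mult_tds_def)
  have cont: "continuous_on UNIV (S n)" if "1 \<le> n" for n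
    using S(1) that by (simp add: mult_tds_def)
  show "norm (f n) \<le> 1" if "f \<in> ?F" for f n
    using that by (cases "n = 0") (auto simp: Suc_le_eq)
  obtain R where "finite R" "\<And>p. prime p \<Longrightarrow> S p \<in> R" using S(2) unfolding finitely_generated_def by auto
  then show "finite (S ` {p. prime p})" by (elim finite_subset[rotated]) auto
  fix f and p :: nat assume f: "f \<in> ?F" and p: "prime p"
  then obtain h where h: "continuous_on UNIV h" "\<And>x. norm (h x) \<le> 1" "\<And>n. 1 \<le> n \<Longrightarrow> f n = h (S n y)"
    by auto
  have p1: "1 \<le> p" using prime_gt_0_nat[OF p] by simp
  have fp: "f (p * n) = h (S p (S n y))" if "1 \<le> n" for n
    using h(3)[of "p * n"] p1 that mult[of p n y] by simp
  show "(\<lambda>n. f (p * n)) \<in> ?F"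
  proof (intro CollectI conjI exI[of _ "\<lambda>x. h (S p x)"])
    show "continuous_on UNIV (\<lambda>x. h (S p x))"
      by (rule continuous_on_compose2[OF h(1) cont[OF p1]]) simp
  qed (use f h fp in auto)
  fix q n :: nat assume q: "prime q" "S p = S q" "0 < n"
  have "1 \<le> q" using prime_gt_0_nat[OF q(1)] by simp
  then have "f (q * n) = h (S q (S n y))"
    using h(3)[of "q * n"] q(3) mult[of q n y] by simp
  then show "f (p * n) = f (q * n)" using fp[of n] q by simp
qed

text \<open>For an orbit, dilation by q composes h with \<open>S q\<close>. Dividing by a bound B
  brings h into the family, and the averages are restricted to integers.\<close>

lemma orbit_averages_asymptotically_invariant:
  fixes S :: "nat \<Rightarrow> 'a::metric_space \<Rightarrow> 'a" and h :: "'a \<Rightarrow> real"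
  assumes S: "mult_tds S" "finitely_generated S" and h: "continuous_on UNIV h"
    and q: "prime q" "\<not> thin {p. prime p \<and> S p = S q}"
  shows "(\<lambda>N. (\<Sum>n=1..N. h (S q (S n y))) / real N - (\<Sum>n=1..N. h (S n y)) / real N) \<longlonglongrightarrow> 0"
proof -
  let ?F = "{f. norm (f 0) \<le> 1 \<and> (\<exists>h. continuous_on UNIV h \<and> (\<forall>x. norm (h x) \<le> 1) \<and> (\<forall>n\<ge>1. f n = h (S n y)))}"
  interpret coloured_family ?F S by (rule coloured_family_orbit[OF S])
  have cpt: "compact (UNIV :: 'a set)" using S(1) by (simp add: mult_tds_def)
  have "bounded (range h)" using compact_continuous_image[OF h cpt] by (rule compact_imp_bounded)
  then obtain B where B: "0 < B" "\<And>x. \<bar>h x\<bar> \<le> B" unfolding bounded_pos by auto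
  define f where "f n = (if n = 0 then 0 else complex_of_real (h (S n y) / B))" for n
  have "f \<in> ?F"
  proof (intro CollectI conjI exI[of _ "\<lambda>x. complex_of_real (h x / B)"])
    show "continuous_on UNIV (\<lambda>x. complex_of_real (h x / B))"
      using B(1) by (intro continuous_intros h) auto
  qed (use B in \<open>auto simp: f_def norm_divide\<close>)
  then have "((\<lambda>x. avg (\<lambda>n. f (q * n)) x - avg f x) \<longlongrightarrow> 0) at_top"
    using q by (intro avg_dilate_tendsto) (simp_all add: class_of_def)
  then have "(\<lambda>N. avg (\<lambda>n. f (q * n)) (real N) - avg f (real N)) \<longlonglongrightarrow> 0"
    by (rule filterlim_compose) (rule filterlim_real_sequentially)
  then have "(\<lambda>N. B * Re (avg (\<lambda>n. f (q * n)) (real N) - avg f (real N))) \<longlonglongrightarrow> B * Re 0"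
    by (intro tendsto_intros)
  moreover have "B * Re (avg f (real N)) = (\<Sum>n=1..N. h (S n y)) / real N" for N
  proof -
    have "(\<Sum>n=1..N. f n) = complex_of_real ((\<Sum>n=1..N. h (S n y)) / B)"
      unfolding sum_divide_distrib of_real_sum by (intro sum.cong refl) (simp add: f_def)
    then have "avg f (real N) = complex_of_real ((\<Sum>n=1..N. h (S n y)) / B / real N)"
      by (simp only: avg_def floor_of_nat nat_int of_real_divide)
    then show ?thesis using B(1) by (simp only: Re_complex_of_real) simp
  qed
  moreover have "B * Re (avg (\<lambda>n. f (q * n)) (real N)) = (\<Sum>n=1..N. h (S q (S n y))) / real N" for N
  proof -
    have "1 \<le> q" using prime_gt_0_nat[OF q(1)] by simp
    then have "(\<Sum>n=1..N. f (q * n)) = complex_of_real ((\<Sum>n=1..N. h (S q (S n y))) / B)"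
      unfolding sum_divide_distrib of_real_sum using S(1)
      by (intro sum.cong refl) (simp add: f_def mult_tds_def)
    then have "avg (\<lambda>n. f (q * n)) (real N) = complex_of_real ((\<Sum>n=1..N. h (S q (S n y))) / B / real N)"
      by (simp only: avg_def floor_of_nat nat_int of_real_divide)
    then show ?thesis using B(1) by (simp only: Re_complex_of_real) simp
  qed
  ultimately show ?thesis by (simp add: right_diff_distrib)
qed

lemma pretends_invariant_of_limit:
  fixes S :: "nat \<Rightarrow> 'a::metric_space \<Rightarrow> 'a"
  assumes S: "mult_tds S" "finitely_generated S" and \<mu>: "borel_prob \<mu>"
    and u: "filterlim u sequentially sequentially"
    and lim: "\<And>h :: 'a \<Rightarrow> real. continuous_on UNIV h \<Longrightarrow>
      (\<lambda>k. (\<Sum>n=1..u k. h (S n y)) / real (u k)) \<longlonglongrightarrow> (\<integral>x. h x \<partial>\<mu>)"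
  shows "pretends_invariant S \<mu>"
proof -
  have cpt: "compact (UNIV :: 'a set)" using S(1) by (simp add: mult_tds_def)
  have s\<mu>: "sets \<mu> = sets borel" using \<mu> by (simp add: borel_prob_def)
  define C where "C T = {p. prime p \<and> S p = T}" for T
  \<comment> \<open>The other primes fill finitely many thin colour classes, so they form a thin
    set.\<close>
  define P where "P = {p. prime p \<and> \<not> thin (C (S p))}"
  have "finite (S ` {p. prime p})"
    using coloured_family.fincol[OF coloured_family_orbit[OF S, of y]] .
  then have "finite {T\<in>S ` {p. prime p}. thin (C T)}" by simp
  then have "thin (\<Union>T\<in>{T\<in>S ` {p. prime p}. thin (C T)}. C T)" by (rule thin_Union) simp
  moreover have "{p. prime p} - P \<subseteq> (\<Union>T\<in>{T\<in>S ` {p. prime p}. thin (C T)}. C T)"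
    by (auto simp: P_def C_def)
  ultimately have "thin ({p. prime p} - P)" by (rule thin_subset)
  moreover have "invariant_under \<mu> (S q)" if q: "q \<in> P" for q
  proof -
    have q1: "prime q" "\<not> thin {p. prime p \<and> S p = S q}" using q by (auto simp: P_def C_def)
    have "continuous_on UNIV (S q)" using S(1) prime_gt_0_nat[OF q1(1)] by (simp add: mult_tds_def Suc_le_eq)
    then have "S q \<in> borel_measurable borel" by (rule borel_measurable_continuous_onI)
    then have meas: "S q \<in> measurable \<mu> \<mu>" using s\<mu> by (simp cong: measurable_cong_sets)
    have "distr \<mu> \<mu> (S q) = \<mu>"
    proof (rule borel_prob_eqI[OF cpt _ \<mu>])
      show "borel_prob (distr \<mu> \<mu> (S q))"
        using \<mu> prob_space.prob_space_distr[OF _ meas] by (simp add: borel_prob_def)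
      fix h :: "'a \<Rightarrow> real" assume h: "continuous_on UNIV h"
      have hm: "h \<in> borel_measurable \<mu>"
        using borel_measurable_continuous_onI[OF h] s\<mu> by (simp cong: measurable_cong_sets)
      have "continuous_on UNIV (\<lambda>x. h (S q x))"
        by (rule continuous_on_compose2[OF h \<open>continuous_on UNIV (S q)\<close>]) simp
      from lim[OF this] lim[OF h]
      have "(\<lambda>k. (\<Sum>n=1..u k. h (S q (S n y))) / real (u k) - (\<Sum>n=1..u k. h (S n y)) / real (u k))
          \<longlonglongrightarrow> (\<integral>x. h (S q x) \<partial>\<mu>) - (\<integral>x. h x \<partial>\<mu>)" by (rule tendsto_diff)
      moreover have "(\<lambda>k. (\<Sum>n=1..u k. h (S q (S n y))) / real (u k) - (\<Sum>n=1..u k. h (S n y)) / real (u k)) \<longlonglongrightarrow> 0"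
        by (rule filterlim_compose[OF orbit_averages_asymptotically_invariant[OF S h q1] u])
      ultimately have "(\<integral>x. h (S q x) \<partial>\<mu>) - (\<integral>x. h x \<partial>\<mu>) = 0" by (rule LIMSEQ_unique)
      then show "(\<integral>x. h x \<partial>distr \<mu> \<mu> (S q)) = (\<integral>x. h x \<partial>\<mu>)"
        using integral_distr[OF meas hm] by simp
    qed
    then show ?thesis using meas by (simp add: invariant_under_def)
  qed
  moreover have "P \<subseteq> {p. prime p}" by (auto simp: P_def)
  ultimately show ?thesis unfolding pretends_invariant_def thin_def by blast
qed

lemma integral_complex_eq_Complex:
  fixes g :: "'a::metric_space \<Rightarrow> complex"
  assumes "compact (UNIV :: 'a set)" "borel_prob \<mu>" "continuous_on UNIV g"
  shows "(\<integral>x. g x \<partial>\<mu>) = Complex (\<integral>x. Re (g x) \<partial>\<mu>) (\<integral>x. Im (g x) \<partial>\<mu>)"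
proof -
  have "integrable \<mu> g" using assms by (rule borel_prob_integrable)
  then show ?thesis by (simp add: complex_eq_iff)
qed

theorem theoremB:
  fixes S :: "nat \<Rightarrow> 'a::metric_space \<Rightarrow> 'a" and \<nu> :: "'a measure"
    and g :: "'a \<Rightarrow> complex" and y :: 'a
  assumes "mult_tds S"
    and "finitely_generated S"
    and "strongly_uniquely_ergodic S"
    and "borel_prob \<nu>" and "pretends_invariant S \<nu>"
    and "continuous_on UNIV g"
  shows "(\<lambda>N. (1 / of_nat N) * (\<Sum>n=1..N. g (S n y))) \<longlonglongrightarrow> (\<integral>x. g x \<partial>\<nu>)"
proof -
  define G where "G N = (1 / of_nat N) * (\<Sum>n=1..N. g (S n y))" for N
  have cpt: "compact (UNIV :: 'a set)" using assms(1) by (simp add: mult_tds_def)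
  \<comment> \<open>If the limit failed, a subsequence staying e away from it would have a further
    subsequence of weakly convergent empirical measures. Their limit pretends to be invariant, so it
    is \<nu>, which is a contradiction.\<close>
  have "(\<lambda>N. G (Suc N)) \<longlonglongrightarrow> (\<integral>x. g x \<partial>\<nu>)"
  proof (rule ccontr)
    assume "\<not> (\<lambda>N. G (Suc N)) \<longlonglongrightarrow> (\<integral>x. g x \<partial>\<nu>)"
    then obtain e where e: "0 < e" "\<not> eventually (\<lambda>N. dist (G (Suc N)) (\<integral>x. g x \<partial>\<nu>) < e) sequentially"
      unfolding tendsto_iff by blast
    then obtain s :: "nat \<Rightarrow> nat" where s: "strict_mono s" "\<And>k. \<not> dist (G (Suc (s k))) (\<integral>x. g x \<partial>\<nu>) < e"
      using not_eventually_sequentiallyD[OF e(2)] by blast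
    obtain r \<mu> where r: "strict_mono r" and \<mu>: "borel_prob \<mu>"
      and lim: "\<And>h :: 'a \<Rightarrow> real. continuous_on UNIV h \<Longrightarrow>
       (\<lambda>k. (\<Sum>n=1..Suc (s (r k)). h (S n y)) / real (Suc (s (r k)))) \<longlonglongrightarrow> (\<integral>x. h x \<partial>\<mu>)"
      using empirical_measures_convergent_subseq[OF cpt s(1), of "\<lambda>n. S n y"] by blast
    have "strict_mono (\<lambda>k. Suc (s (r k)))" using s(1) r by (simp add: strict_mono_def)
    then have "filterlim (\<lambda>k. Suc (s (r k))) sequentially sequentially" by (rule filterlim_subseq)
    then have "pretends_invariant S \<mu>" using lim by (rule pretends_invariant_of_limit[OF assms(1,2) \<mu>])
    then have "\<mu> = \<nu>" using assms(3-5) \<mu> unfolding strongly_uniquely_ergodic_def by blast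
    have "(\<lambda>k. G (Suc (s (r k)))) \<longlonglongrightarrow> (\<integral>x. g x \<partial>\<mu>)"
    proof -
      \<comment> \<open>The weak limit is stated for real test functions, so g is split into its
        real and imaginary parts.\<close>
      have "continuous_on UNIV (\<lambda>x. Re (g x))" "continuous_on UNIV (\<lambda>x. Im (g x))"
        using assms(6) by (intro continuous_intros; simp)+
      from this[THEN lim]
      have "(\<lambda>k. Re (G (Suc (s (r k))))) \<longlonglongrightarrow> (\<integral>x. Re (g x) \<partial>\<mu>)"
        "(\<lambda>k. Im (G (Suc (s (r k))))) \<longlonglongrightarrow> (\<integral>x. Im (g x) \<partial>\<mu>)"
        by (simp_all add: G_def del: of_nat_Suc sum.cl_ivl_Suc)
      from tendsto_Complex[OF this]
      show ?thesis by (simp add: integral_complex_eq_Complex[OF cpt \<mu> assms(6)])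
    qed
    then have "(\<lambda>k. G (Suc (s (r k)))) \<longlonglongrightarrow> (\<integral>x. g x \<partial>\<nu>)" using \<open>\<mu> = \<nu>\<close> by simp
    then have "eventually (\<lambda>k. dist (G (Suc (s (r k)))) (\<integral>x. g x \<partial>\<nu>) < e) sequentially"
      using e(1) by (rule tendstoD)
    then show False using s(2) by simp
  qed
  then show ?thesis unfolding G_def[symmetric] by (rule LIMSEQ_imp_Suc)
qed

end
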